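(* Let $\mathbb{K}$ be a field, let $I\subset S=\mathbb{K}[X_1,\ldots,X_n]$ be a proper monomial ideal, and let $I_\varepsilon\subset S$ be the deformed ideal associated with a generic deformation of $I$. Then $\operatorname{size} I\ge\operatorname{size} I_\varepsilon$.
   Context: Size. Let $J\subset S=\mathbb{K}[X_1,\ldots,X_n]$ be a proper monomial ideal and let $J=\bigcap_{i=1}^s U_i$ be an irredundant primary decomposition with all $U_i$ monomial ideals. The size of $J$ is $\operatorname{size} J=v+(n-h)-1$, where $v$ is the minimum number $t\le s$ such that there exist $i_1<\cdots<i_t$ with $\sqrt{\sum_{j=1}^t U_{i_j}}=\sqrt{\sum_{i=1}^s U_i}$, and $h=\operatorname{height}\sum_{i=1}^s U_i$. This depends only on the set of associated primes of $S/J$ (and on $n$). Deformations. Let $\mathcal{M}=\{m_1,\ldots,m_r\}\subset S$ be a set of monomials and let $a^i=(a^i_1,\ldots,a^i_n)\in\mathbb{N}^n$ be the exponent vector of $m_i$ (here $0\in\mathbb{N}$). A deformation of $\mathcal{M}$ is a set of vectors $\varepsilon_i=(\varepsilon^i_1,\ldots,\varepsilon^i_n)\in\mathbb{N}^n$, $1\le i\le r$, such that for all $i,k\in\{1,\ldots,r\}$ and $j\in\{1,\ldots,n\}$: $$a^i_j>a^k_j\implies a^i_j+\varepsilon^i_j>a^k_j+\varepsilon^k_j,\qquad\text{and}\qquad a^i_j=0\implies\varepsilon^i_j=0.$$ Let $I\subset S$ be a monomial ideal with (finite, monomial) generating set $G_I$. A deformation of $I$ is a deformation of $G_I$, and the deformed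 ideal is $I_\varepsilon=(g\cdot\mathbf{x}^{\varepsilon_g} : g\in G_I)$, where $\varepsilon_g$ is the vector corresponding to $g$ and $\mathbf{x}^{b}=X_1^{b_1}\cdots X_n^{b_n}$. Genericity. A monomial $m\in S$ strictly divides a monomial $m'\in S$ if $m$ divides $m'/X_i$ for each variable $X_i$ dividing $m'$. A monomial ideal is generic if for any two distinct minimal generators $m,m'$ having the same positive degree in some variable, there exists a third minimal generator $m''$ that strictly divides $\operatorname{lcm}(m,m')$. A deformation of $I$ is generic if the deformed ideal $I_\varepsilon$ is generic. *)

theory Defs
  imports
    "HOL-Library.Poly_Mapping"
    "HOL-Library.Extended_Real"
    "HOL-Algebra.Algebraic_Closure_Type"
begin

section \<open>Primary ideals, radicals and heights in a commutative ring\<close>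

definition radical :: "('a, 'b) ring_scheme \<Rightarrow> 'a set \<Rightarrow> 'a set" where
  "radical R J = {a \<in> carrier R. \<exists>k::nat. a [^]\<^bsub>R\<^esub> k \<in> J}"

definition primary_ideal :: "('a, 'b) ring_scheme \<Rightarrow> 'a set \<Rightarrow> bool" where
  "primary_ideal R Q \<longleftrightarrow>
     ideal Q R \<and> Q \<noteq> carrier R \<and>
     (\<forall>a\<in>carrier R. \<forall>b\<in>carrier R. a \<otimes>\<^bsub>R\<^esub> b \<in> Q \<longrightarrow> a \<in> Q \<or> b \<in> radical R Q)"

definition prime_height :: "('a, 'b) ring_scheme \<Rightarrow> 'a set \<Rightarrow> enat" where
  "prime_height R P =
     Sup {enat k | k. \<exists>C :: nat \<Rightarrow> 'a set.
            (\<forall>i\<le>k. primeideal (C i) R) \<and> (\<forall>i<k. C i \<subset> C (Suc i)) \<and> C k = P}"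

definition height :: "('a, 'b) ring_scheme \<Rightarrow> 'a set \<Rightarrow> enat" where
  "height R J = Inf {prime_height R P | P. primeideal P R \<and> J \<subseteq> P}"

text \<open>The sum of a family of ideals is the smallest ideal containing all of them.\<close>

definition ideal_sum :: "('a, 'b) ring_scheme \<Rightarrow> 'i set \<Rightarrow> ('i \<Rightarrow> 'a set) \<Rightarrow> 'a set" where
  "ideal_sum R T U = Idl\<^bsub>R\<^esub> (\<Union>i\<in>T. U i)"


section \<open>Monomials and monomial ideals\<close>

text \<open>
  The polynomial ring in \<open>n\<close> variables over \<open>'k\<close>: the variables are indexed by a finite type \<open>'n\<close>
  with \<open>n = card (UNIV :: 'n set)\<close>, and a polynomial maps exponent vectors to coefficients (almost all zero).
  Multiplication is the convolution product of \<^theory>\<open>HOL-Library.Poly_Mapping\<close>.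
\<close>

type_synonym ('n, 'k) mpoly = "('n \<Rightarrow>\<^sub>0 nat) \<Rightarrow>\<^sub>0 'k"

abbreviation mpoly_ring :: "('n, 'k::comm_ring_1) mpoly ring" where
  "mpoly_ring \<equiv> ring_of_type_algebra"

definition xpow :: "('n \<Rightarrow>\<^sub>0 nat) \<Rightarrow> ('n, 'k::comm_ring_1) mpoly" where
  "xpow a = Poly_Mapping.single a 1"

definition monomial_ideal :: "('n, 'k::comm_ring_1) mpoly set \<Rightarrow> bool" where
  "monomial_ideal J \<longleftrightarrow> (\<exists>A. J = Idl\<^bsub>mpoly_ring\<^esub> (xpow ` A))"

text \<open>In what follows monomials are represented by their exponent vectors; \<open>expo a j\<close> is the exponent of the variable \<open>j\<close>.\<close>

abbreviation expo :: "('n \<Rightarrow>\<^sub>0 nat) \<Rightarrow> 'n \<Rightarrow> nat" where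
  "expo \<equiv> Poly_Mapping.lookup"

definition mdivides :: "('n \<Rightarrow>\<^sub>0 nat) \<Rightarrow> ('n \<Rightarrow>\<^sub>0 nat) \<Rightarrow> bool" where
  "mdivides a b \<longleftrightarrow> (\<forall>j. expo a j \<le> expo b j)"

definition strictly_divides :: "('n \<Rightarrow>\<^sub>0 nat) \<Rightarrow> ('n \<Rightarrow>\<^sub>0 nat) \<Rightarrow> bool" where
  "strictly_divides a b \<longleftrightarrow> (\<forall>i. expo b i > 0 \<longrightarrow> mdivides a (b - Poly_Mapping.single i 1))"

definition mlcm :: "('n::finite \<Rightarrow>\<^sub>0 nat) \<Rightarrow> ('n \<Rightarrow>\<^sub>0 nat) \<Rightarrow> ('n \<Rightarrow>\<^sub>0 nat)" where
  "mlcm a b = Abs_poly_mapping (\<lambda>j. max (expo a j) (expo b j))"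

lemma expo_mlcm: "expo (mlcm a b) j = max (expo a j) (expo b j)"
  by (simp add: mlcm_def)

definition minimal_generating_set ::
    "('n \<Rightarrow>\<^sub>0 nat) set \<Rightarrow> ('n, 'k::comm_ring_1) mpoly set \<Rightarrow> bool" where
  "minimal_generating_set A J \<longleftrightarrow>
     Idl\<^bsub>mpoly_ring\<^esub> (xpow ` A) = J \<and> (\<forall>B. B \<subset> A \<longrightarrow> Idl\<^bsub>mpoly_ring\<^esub> (xpow ` B) \<noteq> J)"

definition minimal_generator ::
    "('n, 'k::comm_ring_1) mpoly set \<Rightarrow> ('n \<Rightarrow>\<^sub>0 nat) \<Rightarrow> bool" where
  "minimal_generator J a \<longleftrightarrow> (\<exists>A. minimal_generating_set A J \<and> a \<in> A)"

definition generic_ideal :: "('n::finite, 'k::comm_ring_1) mpoly set \<Rightarrow> bool" where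
  "generic_ideal J \<longleftrightarrow>
     monomial_ideal J \<and>
     (\<forall>m m'. minimal_generator J m \<and> minimal_generator J m' \<and> m \<noteq> m' \<and>
        (\<exists>j. expo m j = expo m' j \<and> expo m j > 0) \<longrightarrow>
        (\<exists>m''. minimal_generator J m'' \<and> m'' \<noteq> m \<and> m'' \<noteq> m' \<and>
               strictly_divides m'' (mlcm m m')))"


section \<open>Deformations\<close>

text \<open>The vector attached to the generator \<open>a\<close> is \<open>\<epsilon> a\<close>; values outside \<open>G\<close> are irrelevant.\<close>

definition deformation ::
    "('n \<Rightarrow>\<^sub>0 nat) set \<Rightarrow> (('n \<Rightarrow>\<^sub>0 nat) \<Rightarrow> ('n \<Rightarrow>\<^sub>0 nat)) \<Rightarrow> bool" where
  "deformation G \<epsilon> \<longleftrightarrow>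
     (\<forall>a\<in>G. \<forall>b\<in>G. \<forall>j. expo a j > expo b j \<longrightarrow>
        expo a j + expo (\<epsilon> a) j > expo b j + expo (\<epsilon> b) j) \<and>
     (\<forall>a\<in>G. \<forall>j. expo a j = 0 \<longrightarrow> expo (\<epsilon> a) j = 0)"

definition deformed_ideal ::
    "('n \<Rightarrow>\<^sub>0 nat) set \<Rightarrow> (('n \<Rightarrow>\<^sub>0 nat) \<Rightarrow> ('n \<Rightarrow>\<^sub>0 nat)) \<Rightarrow> ('n, 'k::comm_ring_1) mpoly set" where
  "deformed_ideal G \<epsilon> = Idl\<^bsub>mpoly_ring\<^esub> ((\<lambda>a. xpow a * xpow (\<epsilon> a)) ` G)"


section \<open>Size\<close>

definition irredundant_monomial_primary_decomposition ::
    "nat \<Rightarrow> (nat \<Rightarrow> ('n, 'k::comm_ring_1) mpoly set) \<Rightarrow> ('n, 'k) mpoly set \<Rightarrow> bool" where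
  "irredundant_monomial_primary_decomposition s U J \<longleftrightarrow>
     (\<forall>i\<in>{1..s}. monomial_ideal (U i) \<and> primary_ideal mpoly_ring (U i)) \<and>
     J = (\<Inter>i\<in>{1..s}. U i) \<and>
     (\<forall>i\<in>{1..s}. (\<Inter>j\<in>{1..s} - {i}. U j) \<noteq> J)"

text \<open>
  A selection \<open>i\<^sub>1 < \<dots> < i\<^sub>t\<close> of indices is a set \<open>T\<close> of cardinality \<open>t\<close>.  At least one index has
  to be selected; this only matters for the zero ideal.
\<close>

definition decomposition_v :: "nat \<Rightarrow> (nat \<Rightarrow> ('n, 'k::comm_ring_1) mpoly set) \<Rightarrow> nat" where
  "decomposition_v s U =
     (LEAST t. \<exists>T. T \<subseteq> {1..s} \<and> T \<noteq> {} \<and> card T = t \<and>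
        radical mpoly_ring (ideal_sum mpoly_ring T U) =
        radical mpoly_ring (ideal_sum mpoly_ring {1..s} U))"

text \<open>
  Heights are defined as extended natural numbers, so the size is taken in the extended reals.  The
  heights occurring here are at most \<open>n\<close>, so the subtraction is the usual one.
\<close>

definition decomposition_size ::
    "nat \<Rightarrow> (nat \<Rightarrow> ('n::finite, 'k::comm_ring_1) mpoly set) \<Rightarrow> ereal" where
  "decomposition_size s U =
     ereal (real (decomposition_v s U)) +
     (ereal (real (card (UNIV :: 'n set))) - ereal_of_enat (height mpoly_ring (ideal_sum mpoly_ring {1..s} U))) - 1"

text \<open>The size of a proper monomial ideal does not depend on the decomposition.\<close>

definition ideal_size :: "('n::finite, 'k::comm_ring_1) mpoly set \<Rightarrow> ereal" where
  "ideal_size J =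
     (THE d. \<exists>s U. irredundant_monomial_primary_decomposition s U J \<and> d = decomposition_size s U)"

end

(*
  Let M be the set of exponent vectors of the monomials in a monomial ideal J.  The associated primes
  of S/J are read off from M: a set F of variables generates one of them iff some monomial, after
  inverting the variables outside F, lies outside J while its multiples by the variables in F all lie
  in J.  By primary decomposition, size J is the least number v of these sets F with the full union V,
  plus n - ht(V) - 1.

  Every associated prime P of I is associated to the deformed ideal: a deformation preserves
  thresholds, so a monomial witnessing P yields a monomial outside the localised deformed ideal, and a
  maximal multiple of it in the variables of P witnesses P there.  Hence V grows to some V', v grows by
  at most |V' - V|, one extra prime for each new variable, and the height grows at least by
  |V' - V|, since a chain of primes ending in (V) extends to one ending in (V').
*)
theory Submission
  imports Defs
begin

section \<open>Rings given by type classes\<close>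

lemma mpoly_ring_simps [simp]:
  "carrier ring_of_type_algebra = UNIV"
  "a \<otimes>\<^bsub>ring_of_type_algebra\<^esub> b = a * b"
  "\<one>\<^bsub>ring_of_type_algebra\<^esub> = 1"
  "\<zero>\<^bsub>ring_of_type_algebra\<^esub> = 0"
  "a \<oplus>\<^bsub>ring_of_type_algebra\<^esub> b = a + b"
  by (simp_all add: ring_of_type_algebra_def)

lemma nat_pow_ring_of_type_algebra [simp]:
  "a [^]\<^bsub>ring_of_type_algebra\<^esub> (k::nat) = (a::'a::comm_ring_1) ^ k"
proof (induction k)
  case (Suc k)
  interpret ring "ring_of_type_algebra :: 'a ring" by rule
  show ?case using Suc by (simp add: mult.commute)
qed (simp add: nat_pow_def)

text \<open>Additive inverses come from multiplication by \<open>-1\<close>, so the ideal locale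
  reduces to three closure conditions that automation can use.\<close>

lemma ideal_ring_of_type_algebra_iff:
  fixes J :: "'a::comm_ring_1 set"
  shows "ideal J ring_of_type_algebra \<longleftrightarrow>
    0 \<in> J \<and> (\<forall>a\<in>J. \<forall>b\<in>J. a + b \<in> J) \<and> (\<forall>a\<in>J. \<forall>r. r * a \<in> J)" (is "?L \<longleftrightarrow> ?R")
proof
  assume ?L
  then interpret ideal J "ring_of_type_algebra" .
  show ?R
    using additive_subgroup.zero_closed[OF is_additive_subgroup]
      additive_subgroup.a_closed[OF is_additive_subgroup] I_l_closed by auto
next
  assume R: ?R
  interpret cring "ring_of_type_algebra :: 'a ring" by rule
  have neg: "- a \<in> J" if "a \<in> J" for a
    using R that by (metis mult_minus1)
  have inv: "inv\<^bsub>add_monoid ring_of_type_algebra\<^esub> a = - a" for a :: 'a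
    using minus_equality[of "- a" a] by (simp add: a_inv_def)
  have "subgroup J (add_monoid ring_of_type_algebra)"
    by (rule group.subgroupI[OF a_group]) (use R neg inv in auto)
  then show ?L
    by (rule idealI[OF ring_axioms]) (use R in \<open>auto simp: mult.commute\<close>)
qed

section \<open>Monomial ideals and sets of exponents\<close>

definition upset :: "('n \<Rightarrow>\<^sub>0 nat) set \<Rightarrow> bool" where
  "upset M \<longleftrightarrow> (\<forall>m\<in>M. \<forall>m'. m + m' \<in> M)"

text \<open>For an upset \<open>M\<close> this is the monomial ideal whose monomials have their
  exponents in \<open>M\<close>. Inclusions and intersections of such ideals become those of
  exponent sets, and sums become unions.\<close>

definition monomial_span :: "('n \<Rightarrow>\<^sub>0 nat) set \<Rightarrow> ('n, 'k::comm_ring_1) mpoly set" where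
  "monomial_span M = {f. Poly_Mapping.keys f \<subseteq> M}"

lemma upsetD: "upset M \<Longrightarrow> m \<in> M \<Longrightarrow> m + m' \<in> M"
  by (simp add: upset_def)

lemma upset_mono:
  assumes "upset M" "m \<in> M" "\<And>j. expo m j \<le> expo m' j"
  shows "m' \<in> M"
proof -
  have "m' = m + (m' - m)"
    by (rule poly_mapping_eqI) (simp add: lookup_add lookup_minus assms(3))
  then show ?thesis using upsetD assms by metis
qed

lemma xpow_in_monomial_span [simp]:
  "(xpow m :: ('n, 'k::comm_ring_1) mpoly) \<in> monomial_span M \<longleftrightarrow> m \<in> M"
  by (simp add: monomial_span_def xpow_def)

lemma monomial_span_subset_iff [simp]:
  "(monomial_span M :: ('n, 'k::comm_ring_1) mpoly set) \<subseteq> monomial_span N \<longleftrightarrow> M \<subseteq> N"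
proof
  assume sub: "(monomial_span M :: ('n, 'k) mpoly set) \<subseteq> monomial_span N"
  show "M \<subseteq> N"
  proof
    fix m assume "m \<in> M"
    then have "(xpow m :: ('n, 'k) mpoly) \<in> monomial_span M" by simp
    with sub have "(xpow m :: ('n, 'k) mpoly) \<in> monomial_span N" by (rule subsetD)
    then show "m \<in> N" by simp
  qed
qed (auto simp: monomial_span_def)

lemma monomial_span_eq_iff [simp]:
  "(monomial_span M :: ('n, 'k::comm_ring_1) mpoly set) = monomial_span N \<longleftrightarrow> M = N"
  by (auto simp: set_eq_subset)

lemma monomial_span_UNIV [simp]: "monomial_span UNIV = UNIV"
  by (simp add: monomial_span_def)

lemma monomial_span_INT: "monomial_span (\<Inter>i\<in>T. M i) = (\<Inter>i\<in>T. monomial_span (M i))"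
  by (auto simp: monomial_span_def)

lemma ideal_monomial_span:
  assumes "upset M"
  shows "ideal (monomial_span M :: ('n, 'k::comm_ring_1) mpoly set) mpoly_ring"
  unfolding ideal_ring_of_type_algebra_iff monomial_span_def
proof (intro conjI ballI allI; unfold mem_Collect_eq)
  fix f g :: "('n, 'k) mpoly" assume "Poly_Mapping.keys f \<subseteq> M" "Poly_Mapping.keys g \<subseteq> M"
  then show "Poly_Mapping.keys (f + g) \<subseteq> M" using keys_add[of f g] by blast
next
  fix f r :: "('n, 'k) mpoly" assume f: "Poly_Mapping.keys f \<subseteq> M"
  have "a + b \<in> M" if "b \<in> Poly_Mapping.keys f" for a b
    using upsetD[OF assms, of b a] f that by (auto simp: add.commute)
  then show "Poly_Mapping.keys (r * f) \<subseteq> M" using keys_mult[of r f] by blast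
qed simp

text \<open>A polynomial is the sum of its terms, each a constant times a monomial. This reduces
  inclusions of monomial ideals to monomials.\<close>

lemma in_ideal_if_monomials:
  fixes f :: "('n, 'k::comm_ring_1) mpoly"
  assumes J: "ideal J mpoly_ring"
    and keys: "\<And>m. m \<in> Poly_Mapping.keys f \<Longrightarrow> xpow m \<in> J"
  shows "f \<in> J"
proof -
  have f: "f = (\<Sum>m\<in>Poly_Mapping.keys f. Poly_Mapping.single 0 (Poly_Mapping.lookup f m) * xpow m)"
    by (rule poly_mapping_eqI)
      (auto simp: lookup_sum lookup_single xpow_def mult_single when_def in_keys_iff)
  have "(\<Sum>m\<in>K. Poly_Mapping.single 0 (Poly_Mapping.lookup f m) * xpow m) \<in> J"
    if "finite K" "K \<subseteq> Poly_Mapping.keys f" for K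
    using that
    by (induction K) (use J keys in \<open>auto simp: ideal_ring_of_type_algebra_iff\<close>)
  from this[OF finite_keys order_refl] show ?thesis by (subst f)
qed

section \<open>Ideals generated by monomials\<close>

definition upset_of :: "('n \<Rightarrow>\<^sub>0 nat) set \<Rightarrow> ('n \<Rightarrow>\<^sub>0 nat) set" where
  "upset_of A = {m. \<exists>a\<in>A. \<forall>j. expo a j \<le> expo m j}"

lemma upset_upset_of: "upset (upset_of A)"
  by (clarsimp simp: upset_def upset_of_def lookup_add) (meson trans_le_add1)

lemma subset_upset_of: "A \<subseteq> upset_of A"
  by (auto simp: upset_of_def)

lemma upset_of_subset: "upset M \<Longrightarrow> A \<subseteq> M \<Longrightarrow> upset_of A \<subseteq> M"
  by (auto simp: upset_of_def intro: upset_mono)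

lemma Idl_eqI:
  assumes "ideal J R" "B \<subseteq> J" "\<And>K. ideal K R \<Longrightarrow> B \<subseteq> K \<Longrightarrow> J \<subseteq> K"
  shows "Idl\<^bsub>R\<^esub> B = J"
  using assms by (auto simp: genideal_def)

lemma xpow_add: "xpow (a + b) = (xpow a * xpow b :: ('n, 'k::comm_ring_1) mpoly)"
  by (simp add: xpow_def mult_single)

lemma ideal_xpow_mono:
  assumes "ideal J (mpoly_ring :: ('n, 'k::comm_ring_1) mpoly ring)" "xpow a \<in> J"
    "\<And>j. expo a j \<le> expo m j"
  shows "xpow m \<in> J"
proof -
  have "m = (m - a) + a"
    by (rule poly_mapping_eqI) (simp add: lookup_add lookup_minus assms(3))
  then have "xpow m = xpow (m - a) * (xpow a :: ('n, 'k) mpoly)" using xpow_add by metis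
  then show ?thesis using assms(1,2) by (simp add: ideal_ring_of_type_algebra_iff)
qed

lemma Idl_xpow:
  "Idl\<^bsub>mpoly_ring\<^esub> (xpow ` A) = (monomial_span (upset_of A) :: ('n, 'k::comm_ring_1) mpoly set)"
proof (rule Idl_eqI)
  show "xpow ` A \<subseteq> (monomial_span (upset_of A) :: ('n, 'k) mpoly set)"
    by (intro image_subsetI) (simp add: subset_upset_of[THEN subsetD])
next
  fix K :: "('n, 'k) mpoly set" assume K: "ideal K mpoly_ring" "xpow ` A \<subseteq> K"
  have "xpow m \<in> K" if m: "m \<in> upset_of A" for m
  proof -
    from m obtain a where "a \<in> A" and le: "\<And>j. expo a j \<le> expo m j"
      by (auto simp: upset_of_def)
    with K(2) have "xpow a \<in> K" by blast
    then show ?thesis by (rule ideal_xpow_mono[OF K(1) _ le])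
  qed
  then have *: "f \<in> K" if "Poly_Mapping.keys f \<subseteq> upset_of A" for f
    using that by (blast intro: in_ideal_if_monomials[OF K(1)])
  show "monomial_span (upset_of A) \<subseteq> K"
  proof
    fix f :: "('n, 'k) mpoly" assume "f \<in> monomial_span (upset_of A)"
    then show "f \<in> K" by (intro *) (simp add: monomial_span_def)
  qed
qed (rule ideal_monomial_span[OF upset_upset_of])

lemma upset_of_upset: "upset M \<Longrightarrow> upset_of M = M"
  by (simp add: subset_antisym subset_upset_of upset_of_subset)

lemma monomial_ideal_iff: "monomial_ideal J \<longleftrightarrow> (\<exists>M. upset M \<and> J = monomial_span M)"
proof
  assume "\<exists>M. upset M \<and> J = monomial_span M"
  then obtain M where "upset M" "J = monomial_span M" by blast
  then have "J = Idl\<^bsub>mpoly_ring\<^esub> (xpow ` M)" by (simp add: Idl_xpow upset_of_upset)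
  then show "monomial_ideal J" unfolding monomial_ideal_def by (rule exI)
next
  assume "monomial_ideal J"
  then obtain A where "J = Idl\<^bsub>mpoly_ring\<^esub> (xpow ` A)" unfolding monomial_ideal_def by (rule exE)
  then have "J = monomial_span (upset_of A)" by (simp only: Idl_xpow)
  with upset_upset_of[of A] have "upset (upset_of A) \<and> J = monomial_span (upset_of A)" by (rule conjI)
  then show "\<exists>M. upset M \<and> J = monomial_span M" by (rule exI)
qed

lemma ideal_sum_monomial_span:
  assumes "\<And>i. i \<in> T \<Longrightarrow> upset (M i)"
  shows "ideal_sum mpoly_ring T (\<lambda>i. monomial_span (M i)) =
    (monomial_span (\<Union>i\<in>T. M i) :: ('n, 'k::comm_ring_1) mpoly set)"
  unfolding ideal_sum_def
proof (rule Idl_eqI)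
  show "ideal (monomial_span (\<Union>i\<in>T. M i) :: ('n, 'k) mpoly set) mpoly_ring"
    using assms by (intro ideal_monomial_span) (auto simp: upset_def)
next
  fix K :: "('n, 'k) mpoly set"
  assume K: "ideal K mpoly_ring" and sub: "(\<Union>i\<in>T. monomial_span (M i)) \<subseteq> K"
  have "xpow m \<in> K" if "i \<in> T" "m \<in> M i" for i m
  proof -
    have "xpow m \<in> (\<Union>i\<in>T. monomial_span (M i) :: ('n, 'k) mpoly set)" using that by auto
    then show ?thesis using sub by blast
  qed
  then have *: "f \<in> K" if "Poly_Mapping.keys f \<subseteq> (\<Union>i\<in>T. M i)" for f
    using that by (blast intro: in_ideal_if_monomials[OF K])
  show "monomial_span (\<Union>i\<in>T. M i) \<subseteq> K"
  proof
    fix f :: "('n, 'k) mpoly" assume "f \<in> monomial_span (\<Union>i\<in>T. M i)"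
    then show "f \<in> K" by (intro *) (simp add: monomial_span_def)
  qed
qed (auto simp: monomial_span_def)

section \<open>Monomial primary ideals and radicals\<close>

text \<open>By cancellation \<open>a' = a\<close> forces \<open>b' = b\<close>, so at most one pair
  of terms contributes to the coefficient at \<open>a + b\<close>, and nothing can cancel
  it.\<close>

lemma lookup_mult_unique:
  fixes f g :: "('n, 'k::comm_ring_1) mpoly"
  assumes "\<And>a' b'. a' \<in> Poly_Mapping.keys f \<Longrightarrow> b' \<in> Poly_Mapping.keys g \<Longrightarrow>
      a' + b' = a + b \<Longrightarrow> a' = a"
  shows "Poly_Mapping.lookup (f * g) (a + b) = Poly_Mapping.lookup f a * Poly_Mapping.lookup g b"
proof -
  have "Poly_Mapping.lookup f l * (\<Sum>q. Poly_Mapping.lookup g q when a + b = l + q)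
      = (Poly_Mapping.lookup f a * Poly_Mapping.lookup g b when l = a)" for l
  proof (cases "l = a")
    case False
    have "(Poly_Mapping.lookup g q when a + b = l + q) = 0" if "Poly_Mapping.lookup f l \<noteq> 0" for q
      using assms[of l q] that False by (metis in_keys_iff when_def)
    then show ?thesis using False by (cases "Poly_Mapping.lookup f l = 0") auto
  qed simp
  then show ?thesis by (simp add: lookup_mult)
qed

text \<open>The index type carries no order. Renaming the variables by natural numbers moves the
  exponents into a type with a linear order compatible with addition, which singles out largest
  terms.\<close>

lemma ex_additive_embedding:
  "\<exists>\<phi> :: ('n::finite \<Rightarrow>\<^sub>0 nat) \<Rightarrow> (nat \<Rightarrow>\<^sub>0 nat). inj \<phi> \<and> (\<forall>a b. \<phi> (a + b) = \<phi> a + \<phi> b)"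
proof -
  obtain h :: "'n \<Rightarrow> nat" where h: "inj h"
    using finite_imp_inj_to_nat_seg[of "UNIV :: 'n set"] by auto
  define \<phi> where "\<phi> m = Abs_poly_mapping (\<lambda>k. if k \<in> range h then expo m (the_inv h k) else 0)"
    for m :: "'n \<Rightarrow>\<^sub>0 nat"
  have look: "expo (\<phi> m) k = (if k \<in> range h then expo m (the_inv h k) else 0)" for m k
    unfolding \<phi>_def by (subst lookup_Abs_poly_mapping) (auto intro: finite_subset[of _ "range h"])
  have "inj \<phi>"
  proof (rule injI, rule poly_mapping_eqI)
    fix a b j assume "\<phi> a = \<phi> b"
    then show "expo a j = expo b j"
      using look[of a "h j"] look[of b "h j"] h by (simp add: the_inv_f_f)
  qed
  moreover have "\<phi> (a + b) = \<phi> a + \<phi> b" for a b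
    by (rule poly_mapping_eqI) (simp add: look lookup_add)
  ultimately show ?thesis by blast
qed

text \<open>Freedom outside \<open>F\<close> models inverting the variables outside
  \<open>F\<close>: for an upset \<open>M\<close>, some element of \<open>M\<close> agrees with
  \<open>m\<close> on \<open>F\<close> iff the monomial \<open>m\<close> lies in the localised
  ideal.\<close>

definition agree :: "'n set \<Rightarrow> ('n \<Rightarrow>\<^sub>0 nat) \<Rightarrow> ('n \<Rightarrow>\<^sub>0 nat) \<Rightarrow> bool" where
  "agree F m m' \<longleftrightarrow> (\<forall>j\<in>F. expo m j = expo m' j)"

definition degree_on :: "'n set \<Rightarrow> ('n \<Rightarrow>\<^sub>0 nat) \<Rightarrow> nat" where
  "degree_on F m = (\<Sum>j\<in>F. expo m j)"

text \<open>The exponents of the monomials in the ideal generated by the variables in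
  \<open>F\<close>.\<close>

definition meets :: "'n set \<Rightarrow> ('n \<Rightarrow>\<^sub>0 nat) set" where
  "meets F = {m. \<exists>j\<in>F. expo m j > 0}"

lemma degree_on_add: "degree_on F (a + b) = degree_on F a + degree_on F b"
  by (simp add: degree_on_def lookup_add sum.distrib)

lemma notin_meets_iff: "m \<notin> meets (F :: 'n::finite set) \<longleftrightarrow> degree_on F m = 0"
  by (auto simp: meets_def degree_on_def)

lemma upset_meets: "upset (meets F)"
  by (auto simp: upset_def meets_def lookup_add)

text \<open>Initial terms: an additive order in which the degree in \<open>F\<close> comes first isolates one monomial
  of the product.\<close>

lemma keys_mult_subset_imp:
  fixes f g :: "('n::finite, 'k::idom) mpoly"
  assumes M: "upset M" "\<And>m m'. m \<in> M \<Longrightarrow> agree F m m' \<Longrightarrow> m' \<in> M"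
    and fg: "Poly_Mapping.keys (f * g) \<subseteq> M"
    and g: "\<not> Poly_Mapping.keys g \<subseteq> meets F"
  shows "Poly_Mapping.keys f \<subseteq> M"
proof (rule ccontr)
  assume f: "\<not> Poly_Mapping.keys f \<subseteq> M"
  obtain \<phi> :: "('n \<Rightarrow>\<^sub>0 nat) \<Rightarrow> (nat \<Rightarrow>\<^sub>0 nat)" where
    \<phi>: "inj \<phi>" "\<And>a b. \<phi> (a + b) = \<phi> a + \<phi> b"
    using ex_additive_embedding by blast
  define A where "A = Poly_Mapping.keys f - M"
  define d where "d = Min (degree_on F ` A)"
  \<comment> \<open>Candidates for the isolated term: in \<open>A'\<close> the terms of
    \<open>f\<close> outside \<open>M\<close> of least degree in \<open>F\<close>, in
    \<open>B'\<close> the terms of \<open>g\<close> of degree 0 in \<open>F\<close>. The order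
    transported by \<open>\<phi>\<close> breaks ties.\<close>
  define A' where "A' = {a \<in> A. degree_on F a = d}"
  define B' where "B' = Poly_Mapping.keys g - meets F"
  have A: "finite A" "A \<noteq> {}" using f by (auto simp: A_def)
  then have "d \<in> degree_on F ` A" unfolding d_def by (intro Min_in) auto
  then have A': "finite A'" "A' \<noteq> {}" using A(1) by (auto simp: A'_def)
  have d: "d \<le> degree_on F a" if "a \<in> A" for a using that A(1) by (auto simp: d_def)
  have B': "finite B'" "B' \<noteq> {}" using g by (auto simp: B'_def)
  obtain a where a: "a \<in> A'" "\<And>a'. a' \<in> A' \<Longrightarrow> \<phi> a' \<le> \<phi> a"
    using Max_in[of "\<phi> ` A'"] Max_ge[of "\<phi> ` A'"] A' by fastforce
  obtain b where b: "b \<in> B'" "\<And>b'. b' \<in> B' \<Longrightarrow> \<phi> b' \<le> \<phi> b"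
    using Max_in[of "\<phi> ` B'"] Max_ge[of "\<phi> ` B'"] B' by fastforce
  have b0: "degree_on F b = 0" using b(1) by (simp add: B'_def notin_meets_iff)
  have "agree F (a + b) a"
    using b(1) by (auto simp: agree_def B'_def meets_def lookup_add)
  then have abM: "a + b \<notin> M" using M(2) a(1) by (auto simp: A'_def A_def)
  have "Poly_Mapping.lookup (f * g) (a + b) = Poly_Mapping.lookup f a * Poly_Mapping.lookup g b"
  proof (rule lookup_mult_unique)
    fix a' b' assume a': "a' \<in> Poly_Mapping.keys f" and b': "b' \<in> Poly_Mapping.keys g"
      and eq: "a' + b' = a + b"
    \<comment> \<open>A term of \<open>f\<close> with exponent in \<open>M\<close> would put
      \<open>a' + b' = a + b\<close> into the upset \<open>M\<close>.\<close>
    have "a' \<in> A" using a' abM eq upsetD[OF M(1), of a' b'] by (auto simp: A_def)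
    \<comment> \<open>The two degrees are at least \<open>d\<close> and 0 and add up to
      \<open>d + 0\<close>, so both minima are attained.\<close>
    moreover have "degree_on F a' + degree_on F b' = d + 0"
      using arg_cong[OF eq, of "degree_on F"] a(1) b0 by (simp add: degree_on_add A'_def)
    ultimately have "a' \<in> A'" "degree_on F b' = 0"
      using d[of a'] by (auto simp: A'_def)
    then have "\<phi> a' \<le> \<phi> a" "\<phi> b' \<le> \<phi> b"
      using a(2) b(2) b' by (auto simp: B'_def notin_meets_iff)
    moreover have "\<phi> a' + \<phi> b' = \<phi> a + \<phi> b" using \<phi>(2) eq by metis
    ultimately have "\<phi> a' = \<phi> a"
      using add_less_le_mono[of "\<phi> a'" "\<phi> a" "\<phi> b'" "\<phi> b"] by (auto simp: order.order_iff_strict)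
    then show "a' = a" using \<phi>(1) by (simp add: inj_eq)
  qed
  moreover have "Poly_Mapping.lookup f a \<noteq> 0" "Poly_Mapping.lookup g b \<noteq> 0"
    using a(1) b(1) by (auto simp: A'_def A_def B'_def in_keys_iff)
  ultimately have "a + b \<in> Poly_Mapping.keys (f * g)" by (simp add: in_keys_iff)
  then show False using fg abM by blast
qed

section \<open>Ideals generated by variables, and radicals of monomial ideals\<close>

lemma in_meets_single [simp]: "Poly_Mapping.single j (Suc 0) \<in> meets F \<longleftrightarrow> j \<in> F"
  by (auto simp: meets_def lookup_single when_def)

lemma meets_subset_iff [simp]: "meets F \<subseteq> meets F' \<longleftrightarrow> F \<subseteq> F'"
proof
  assume sub: "meets F \<subseteq> meets F'"
  show "F \<subseteq> F'"
  proof
    fix j assume "j \<in> F"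
    then have "Poly_Mapping.single j (Suc 0) \<in> meets F'" using sub by (intro subsetD[OF sub]) simp
    then show "j \<in> F'" by simp
  qed
qed (auto simp: meets_def)

lemma meets_eq_iff [simp]: "meets F = meets F' \<longleftrightarrow> F = F'"
  by (simp add: set_eq_subset)

lemma degree_on_pos_if_meets: "m \<in> meets (F :: 'n::finite set) \<Longrightarrow> 1 \<le> degree_on F m"
  using notin_meets_iff[of m F] by linarith

text \<open>Pigeonhole on exponents: every term of \<open>f ^ i\<close> has degree at least
  \<open>i\<close> in \<open>F\<close>, and once this exceeds the sum of the \<open>k j\<close>,
  some exponent reaches its \<open>k j\<close>.\<close>

lemma span_meets_subset_radical:
  assumes M: "upset M" and pow: "\<And>j. j \<in> F \<Longrightarrow> \<exists>k. Poly_Mapping.single j k \<in> M"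
  shows "(monomial_span (meets F) :: ('n::finite, 'k::comm_ring_1) mpoly set)
    \<subseteq> radical mpoly_ring (monomial_span M)"
proof
  fix f :: "('n, 'k) mpoly" assume f: "f \<in> monomial_span (meets F)"
  obtain k where k: "\<And>j. j \<in> F \<Longrightarrow> Poly_Mapping.single j (k j) \<in> M" using pow by metis
  have deg: "i \<le> degree_on F m" if "m \<in> Poly_Mapping.keys (f ^ i)" for i m
    using that
  proof (induction i arbitrary: m)
    case (Suc i)
    then have "m \<in> Poly_Mapping.keys (f * f ^ i)" by simp
    then obtain a b where "m = a + b" "a \<in> Poly_Mapping.keys f" "b \<in> Poly_Mapping.keys (f ^ i)"
      using keys_mult[of f "f ^ i"] by blast
    moreover have "1 \<le> degree_on F a"
      using f calculation(2) by (intro degree_on_pos_if_meets) (auto simp: monomial_span_def)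
    ultimately show ?case using Suc.IH[of b] by (simp add: degree_on_add)
  qed simp
  define N where "N = Suc (\<Sum>j\<in>F. k j)"
  have "m \<in> M" if m: "m \<in> Poly_Mapping.keys (f ^ N)" for m
  proof -
    have "\<not> (\<Sum>j\<in>F. expo m j) \<le> (\<Sum>j\<in>F. k j)"
      using deg[OF m] by (simp add: N_def degree_on_def)
    then obtain j where "j \<in> F" "k j \<le> expo m j"
      using sum_mono[of F "expo m" k] by fastforce
    then show ?thesis
      by (intro upset_mono[OF M k]) (auto simp: lookup_single when_def)
  qed
  then show "f \<in> radical mpoly_ring (monomial_span M)"
    by (auto simp: radical_def monomial_span_def subset_iff)
qed

text \<open>If \<open>f\<close> had a term outside \<open>meets F\<close>, a factor \<open>f\<close>
  could be cancelled from each power supported in \<open>meets F\<close>; descending to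
  \<open>f ^ 0 = 1\<close> gives a contradiction.\<close>

lemma radical_monomial_span_subset:
  assumes "M \<subseteq> meets F"
  shows "radical mpoly_ring (monomial_span M) \<subseteq>
    (monomial_span (meets F) :: ('n::finite, 'k::idom) mpoly set)"
proof
  fix f :: "('n, 'k) mpoly" assume "f \<in> radical mpoly_ring (monomial_span M)"
  then obtain k where "Poly_Mapping.keys (f ^ k) \<subseteq> meets F"
    using assms by (auto simp: radical_def monomial_span_def)
  then have "Poly_Mapping.keys f \<subseteq> meets F"
  proof (induction k)
    case 0
    then show ?case by (simp add: meets_def)
  next
    case (Suc k)
    show ?case
    proof (rule ccontr)
      assume nf: "\<not> Poly_Mapping.keys f \<subseteq> meets F"
      have "Poly_Mapping.keys (f ^ k) \<subseteq> meets F"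
        by (rule keys_mult_subset_imp[OF upset_meets _ _ nf])
          (use Suc.prems in \<open>auto simp: meets_def agree_def mult.commute\<close>)
      then show False using Suc.IH nf by simp
    qed
  qed
  then show "f \<in> monomial_span (meets F)" by (simp add: monomial_span_def)
qed

lemma radical_monomial_span:
  assumes "upset M" "M \<subseteq> meets F" "\<And>j. j \<in> F \<Longrightarrow> \<exists>k. Poly_Mapping.single j k \<in> M"
  shows "radical mpoly_ring (monomial_span M) =
    (monomial_span (meets F) :: ('n::finite, 'k::idom) mpoly set)"
  using radical_monomial_span_subset[OF assms(2)] span_meets_subset_radical[OF assms(1,3)]
  by (intro equalityI) auto

text \<open>Exponent sets of the monomial primary ideals whose radical is generated by the variables
  in \<open>F\<close>: they contain a power of each of these variables, and the other variables do
  not affect membership.\<close>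

definition primary_on :: "'n set \<Rightarrow> ('n \<Rightarrow>\<^sub>0 nat) set \<Rightarrow> bool" where
  "primary_on F M \<longleftrightarrow> upset M \<and> 0 \<notin> M \<and> (\<forall>j\<in>F. \<exists>k. Poly_Mapping.single j k \<in> M) \<and>
     (\<forall>m m'. m \<in> M \<longrightarrow> agree F m m' \<longrightarrow> m' \<in> M)"

lemma primary_onD:
  assumes "primary_on F M"
  shows "upset M" "0 \<notin> M" "j \<in> F \<Longrightarrow> \<exists>k. Poly_Mapping.single j k \<in> M"
    "m \<in> M \<Longrightarrow> agree F m m' \<Longrightarrow> m' \<in> M"
  using assms unfolding primary_on_def by blast+

lemma keys_mult_subset_primary_on:
  fixes f g :: "('n::finite, 'k::idom) mpoly"
  assumes "primary_on F M" "Poly_Mapping.keys (f * g) \<subseteq> M" "\<not> Poly_Mapping.keys g \<subseteq> meets F"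
  shows "Poly_Mapping.keys f \<subseteq> M"
  by (rule keys_mult_subset_imp[OF _ _ assms(2,3)]) (fact primary_onD[OF assms(1)])+

lemma primary_on_subset_meets:
  assumes "primary_on F M"
  shows "M \<subseteq> meets F"
proof
  fix m assume "m \<in> M"
  then have "\<not> agree F m 0" using primary_onD(2,4)[OF assms] by blast
  then show "m \<in> meets F" by (auto simp: agree_def meets_def)
qed

lemma primary_on_meets: "primary_on F (meets F)"
  unfolding primary_on_def
proof (intro conjI ballI allI impI)
  fix j assume "j \<in> F"
  then have "Poly_Mapping.single j (Suc 0) \<in> meets F" by simp
  then show "\<exists>k. Poly_Mapping.single j k \<in> meets F" by (rule exI)
qed (simp add: upset_meets, auto simp: meets_def agree_def)

lemma radical_span_primary_on:
  "primary_on F M \<Longrightarrow> radical mpoly_ring (monomial_span M) =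
    (monomial_span (meets F) :: ('n::finite, 'k::idom) mpoly set)"
  by (rule radical_monomial_span) (auto intro: primary_onD(1,3) dest: primary_on_subset_meets)

lemma monomial_span_neq_UNIV:
  assumes "0 \<notin> M" shows "monomial_span M \<noteq> (UNIV :: ('n, 'k::comm_ring_1) mpoly set)"
proof -
  have "(xpow 0 :: ('n, 'k) mpoly) \<notin> monomial_span M" using assms by simp
  then show ?thesis by (metis UNIV_I)
qed

text \<open>The radical consists of the polynomials supported in \<open>meets F\<close>, and a
  factor \<open>g\<close> outside it can be cancelled from \<open>f * g\<close>.\<close>

lemma primary_ideal_monomial_span:
  assumes "primary_on F M"
  shows "primary_ideal mpoly_ring (monomial_span M :: ('n::finite, 'k::idom) mpoly set)"
  unfolding primary_ideal_def radical_span_primary_on[OF assms]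
proof (intro conjI ballI impI)
  fix f g :: "('n, 'k) mpoly"
  assume "f \<otimes>\<^bsub>mpoly_ring\<^esub> g \<in> monomial_span M"
  then show "f \<in> monomial_span M \<or> g \<in> monomial_span (meets F)"
    using keys_mult_subset_primary_on[OF assms, of f g] by (auto simp: monomial_span_def)
qed (use primary_onD(1,2)[OF assms] in \<open>simp_all add: ideal_monomial_span monomial_span_neq_UNIV\<close>)

lemma primeideal_span_meets:
  "primeideal (monomial_span (meets F) :: ('n::finite, 'k::idom) mpoly set) mpoly_ring"
proof (rule primeidealI)
  show "cring (mpoly_ring :: ('n, 'k) mpoly ring)" by rule
  show "carrier mpoly_ring \<noteq> (monomial_span (meets F) :: ('n, 'k) mpoly set)"
    using monomial_span_neq_UNIV[OF primary_onD(2)[OF primary_on_meets]] by (metis mpoly_ring_simps(1))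
  fix f g :: "('n, 'k) mpoly"
  assume "f \<otimes>\<^bsub>mpoly_ring\<^esub> g \<in> monomial_span (meets F)"
  then show "f \<in> monomial_span (meets F) \<or> g \<in> monomial_span (meets F)"
    using keys_mult_subset_primary_on[OF primary_on_meets, of f g F] by (auto simp: monomial_span_def)
qed (rule ideal_monomial_span[OF upset_meets])

lemma xpow_single_power:
  "(xpow (Poly_Mapping.single j n) :: ('n, 'k::comm_ring_1) mpoly) ^ k = xpow (Poly_Mapping.single j (k * n))"
  proof (induction k)
  case 0
  then show ?case by (simp add: xpow_def)
next
  case (Suc k)
  then show ?case by (simp add: single_add xpow_add)
qed

definition zero_on :: "'n set \<Rightarrow> ('n::finite \<Rightarrow>\<^sub>0 nat) \<Rightarrow> ('n \<Rightarrow>\<^sub>0 nat)" where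
  "zero_on S m = Abs_poly_mapping (\<lambda>j. if j \<in> S then 0 else expo m j)"

lemma expo_zero_on [simp]: "expo (zero_on S m) j = (if j \<in> S then 0 else expo m j)"
  by (simp add: zero_on_def)

text \<open>For \<open>j\<close> outside the support no power of the variable \<open>j\<close> lies
  in the ideal, so by primariness such powers can be cancelled from any monomial in it. Removing
  these variables one after another leaves a monomial that divides every \<open>m'\<close> agreeing
  with \<open>m\<close> on the support.\<close>

lemma primary_on_if_primary_ideal:
  fixes M :: "('n::finite \<Rightarrow>\<^sub>0 nat) set"
  assumes M: "upset M" and prim: "primary_ideal mpoly_ring (monomial_span M :: ('n, 'k::comm_ring_1) mpoly set)"
  shows "primary_on {j. \<exists>k. Poly_Mapping.single j k \<in> M} M" (is "primary_on ?F M")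
proof -
  have prim_imp: "f \<in> monomial_span M \<or> g \<in> radical mpoly_ring (monomial_span M)"
    if "f * g \<in> monomial_span M" for f g :: "('n, 'k) mpoly"
    using prim that by (simp add: primary_ideal_def)
  have step: "a \<in> M" if "a + Poly_Mapping.single j n \<in> M" "j \<notin> ?F" for a j n
  proof -
    have "xpow a * (xpow (Poly_Mapping.single j n) :: ('n, 'k) mpoly) \<in> monomial_span M"
      using that(1) by (simp flip: xpow_add)
    then have "(xpow a :: ('n, 'k) mpoly) \<in> monomial_span M \<or>
        (xpow (Poly_Mapping.single j n) :: ('n, 'k) mpoly) \<in> radical mpoly_ring (monomial_span M)"
      by (rule prim_imp)
    moreover have "(xpow (Poly_Mapping.single j n) :: ('n, 'k) mpoly) \<notin> radical mpoly_ring (monomial_span M)"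
      using that(2) by (simp add: radical_def xpow_single_power)
    ultimately show ?thesis by simp
  qed
  have zero: "zero_on S m \<in> M" if "m \<in> M" "finite S" "S \<inter> ?F = {}" for m S
    using that(2,3)
  proof (induction S)
    case empty
    have "zero_on {} m = m" by (rule poly_mapping_eqI) simp
    then show ?case using that(1) by simp
  next
    case (insert j S)
    have eq: "zero_on S m = zero_on (insert j S) m + Poly_Mapping.single j (expo (zero_on S m) j)"
      using insert.hyps(2) by (intro poly_mapping_eqI) (auto simp: lookup_add lookup_single when_def)
    have "zero_on S m \<in> M" using insert.IH insert.prems by blast
    then have "zero_on (insert j S) m + Poly_Mapping.single j (expo (zero_on S m) j) \<in> M"
      by (subst (asm) eq)
    then show ?case by (rule step) (use insert.prems in blast)
  qed
  have "m' \<in> M" if "m \<in> M" "agree ?F m m'" for m m'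
  proof (rule upset_mono[OF M])
    show "zero_on (- ?F) m \<in> M" by (rule zero[OF that(1)]) auto
    show "expo (zero_on (- ?F) m) j \<le> expo m' j" for j
      using that(2) by (cases "j \<in> ?F") (simp_all add: agree_def)
  qed
  moreover have "0 \<notin> M"
  proof
    assume "0 \<in> M"
    then have "M = UNIV" using upset_mono[OF M, of 0] by auto
    moreover have "monomial_span M \<noteq> (UNIV :: ('n, 'k) mpoly set)"
      using prim unfolding primary_ideal_def mpoly_ring_simps by (elim conjE)
    ultimately show False by simp
  qed
  ultimately show ?thesis using M unfolding primary_on_def by blast
qed

section \<open>Associated primes\<close>

text \<open>With the variables outside \<open>F\<close> inverted, \<open>m\<close> is not in the
  ideal but its multiples by the variables in \<open>F\<close> are. For an upset \<open>M\<close>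
  the annihilator of \<open>m\<close> modulo the localised ideal is thus the prime generated by
  \<open>F\<close>, so these sets describe the associated primes.\<close>

definition assoc_supports :: "('n \<Rightarrow>\<^sub>0 nat) set \<Rightarrow> 'n set set" where
  "assoc_supports M = {F. \<exists>m. (\<forall>m'\<in>M. \<not> agree F m m') \<and>
     (\<forall>j\<in>F. \<exists>m'\<in>M. agree F (m + Poly_Mapping.single j 1) m')}"

text \<open>\<open>N\<close> stands for the intersection of the other components. Degrees in
  \<open>F\<close> of monomials outside \<open>Q\<close> are bounded, since \<open>Q\<close>
  contains powers of these variables. A monomial of \<open>N\<close> outside \<open>Q\<close> of
  largest degree is a witness: its multiples by variables in \<open>F\<close> stay in
  \<open>N\<close>, hence enter \<open>Q\<close>.\<close>

lemma primary_on_support_in_assoc_supports: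
  assumes prim: "primary_on F Q" and N: "upset N" "\<not> N \<subseteq> Q"
  shows "(F :: 'n::finite set) \<in> assoc_supports (N \<inter> Q)"
proof -
  obtain m0 where m0: "m0 \<in> N" "m0 \<notin> Q" using N(2) by blast
  obtain k where k: "\<And>j. j \<in> F \<Longrightarrow> Poly_Mapping.single j (k j) \<in> Q"
    using primary_onD(3)[OF prim] by metis
  have bound: "degree_on F m \<le> (\<Sum>j\<in>F. k j)" if "m \<notin> Q" for m
    unfolding degree_on_def
  proof (rule sum_mono, rule ccontr)
    fix j assume "j \<in> F" "\<not> expo m j \<le> k j"
    then have "m \<in> Q"
      by (intro upset_mono[OF primary_onD(1)[OF prim] k]) (auto simp: lookup_single when_def)
    then show False using that by simp
  qed
  have "\<exists>m. (m \<in> N \<and> m \<notin> Q) \<and> (\<forall>m'. m' \<in> N \<and> m' \<notin> Q \<longrightarrow> degree_on F m' \<le> degree_on F m)"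
    by (rule ex_has_greatest_nat[where k = m0 and b = "Suc (\<Sum>j\<in>F. k j)"])
      (simp_all add: m0 bound less_Suc_eq_le)
  then obtain m where m: "m \<in> N" "m \<notin> Q"
    and max: "\<And>m'. m' \<in> N \<Longrightarrow> m' \<notin> Q \<Longrightarrow> degree_on F m' \<le> degree_on F m"
    by blast
  have "m + Poly_Mapping.single j 1 \<in> N \<inter> Q" if "j \<in> F" for j
  proof -
    have "1 \<le> degree_on F (Poly_Mapping.single j 1)"
      using that by (intro degree_on_pos_if_meets) simp
    then have "\<not> degree_on F (m + Poly_Mapping.single j 1) \<le> degree_on F m"
      by (simp add: degree_on_add)
    then show ?thesis using max upsetD[OF N(1) m(1)] by blast
  qed
  moreover have "\<not> agree F m m'" if "m' \<in> Q" for m'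
    using primary_onD(4)[OF prim that, of m] m(2) unfolding agree_def by metis
  ultimately show ?thesis
    unfolding assoc_supports_def by (fastforce simp: agree_def)
qed

text \<open>Irredundance makes the preceding lemma apply to each component. Conversely, a witness
  for \<open>Y\<close> is avoided, up to agreement on \<open>Y\<close>, by a single component
  \<open>Q i\<close>, and then \<open>Y = F i\<close>.\<close>

lemma assoc_supports_INT_primary:
  fixes F :: "'i \<Rightarrow> 'n::finite set"
  assumes T: "finite T" and prim: "\<And>i. i \<in> T \<Longrightarrow> primary_on (F i) (Q i)"
    and irred: "\<And>i. i \<in> T \<Longrightarrow> (\<Inter>j\<in>T - {i}. Q j) \<noteq> (\<Inter>j\<in>T. Q j)"
  shows "assoc_supports (\<Inter>i\<in>T. Q i) = F ` T"
proof (intro equalityI subsetI)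
  fix Y assume "Y \<in> F ` T"
  then obtain i where i: "i \<in> T" "Y = F i" by blast
  have eq: "(\<Inter>j\<in>T. Q j) = (\<Inter>j\<in>T - {i}. Q j) \<inter> Q i" using i(1) by blast
  have "upset (\<Inter>j\<in>T - {i}. Q j)"
    using primary_onD(1)[OF prim] by (auto simp: upset_def)
  then show "Y \<in> assoc_supports (\<Inter>i\<in>T. Q i)"
    unfolding eq i(2) using irred[OF i(1)] eq
    by (intro primary_on_support_in_assoc_supports prim i(1)) blast+
next
  fix Y assume "Y \<in> assoc_supports (\<Inter>i\<in>T. Q i)"
  then obtain m where m: "\<And>m'. m' \<in> (\<Inter>i\<in>T. Q i) \<Longrightarrow> \<not> agree Y m m'"
    and ex: "\<And>j. j \<in> Y \<Longrightarrow> \<exists>m'\<in>(\<Inter>i\<in>T. Q i). agree Y (m + Poly_Mapping.single j 1) m'"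
    unfolding assoc_supports_def by blast
  \<comment> \<open>Otherwise each \<open>Q i\<close> has an element \<open>w i\<close> agreeing
    with \<open>m\<close> on \<open>Y\<close>. Adding their exponents outside \<open>Y\<close> gives
    a common multiple of all \<open>w i\<close> that still agrees with \<open>m\<close> on
    \<open>Y\<close>.\<close>
  have "\<exists>i\<in>T. \<forall>m'\<in>Q i. \<not> agree Y m m'"
  proof (rule ccontr)
    assume "\<not> ?thesis"
    then obtain w where w: "\<And>i. i \<in> T \<Longrightarrow> w i \<in> Q i" "\<And>i. i \<in> T \<Longrightarrow> agree Y m (w i)"
      by metis
    define m' where "m' = Abs_poly_mapping (\<lambda>j. if j \<in> Y then expo m j else \<Sum>i\<in>T. expo (w i) j)"
    have look: "expo m' j = (if j \<in> Y then expo m j else \<Sum>i\<in>T. expo (w i) j)" for j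
      by (simp add: m'_def)
    have "m' \<in> Q i" if i: "i \<in> T" for i
    proof (rule upset_mono[OF primary_onD(1)[OF prim[OF i]] w(1)[OF i]])
      show "expo (w i) j \<le> expo m' j" for j
        using w(2)[OF i] T i by (auto simp: look agree_def intro: member_le_sum)
    qed
    moreover have "agree Y m m'" by (simp add: agree_def look)
    ultimately show False using m by blast
  qed
  then obtain i where i: "i \<in> T" "\<And>m'. m' \<in> Q i \<Longrightarrow> \<not> agree Y m m'" by blast
  have "Y = F i"
  proof (intro equalityI subsetI)
    fix j assume j: "j \<in> Y"
    show "j \<in> F i"
    proof (rule ccontr)
      assume nj: "j \<notin> F i"
      obtain m' where m': "m' \<in> Q i" "agree Y (m + Poly_Mapping.single j 1) m'"
        using ex[OF j] i(1) by blast
      \<comment> \<open>Resetting the exponent at \<open>j\<close> to that of \<open>m\<close> keeps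
        \<open>m'\<close> in \<open>Q i\<close>, since \<open>j\<close> is outside
        \<open>F i\<close>, yet undoes the multiplication by the variable \<open>j\<close>.\<close>
      define m'' where "m'' = Abs_poly_mapping ((expo m')(j := expo m j))"
      have look: "expo m'' l = (if l = j then expo m j else expo m' l)" for l
        by (simp add: m''_def)
      have "m'' \<in> Q i"
        by (rule primary_onD(4)[OF prim[OF i(1)] m'(1)]) (use nj in \<open>auto simp: agree_def look\<close>)
      moreover have "agree Y m m''"
        using m'(2) by (auto simp: agree_def look lookup_add lookup_single when_def)
      ultimately show False using i(2) by blast
    qed
  next
    fix j assume j: "j \<in> F i"
    then obtain k where "Poly_Mapping.single j k \<in> Q i" using primary_onD(3)[OF prim[OF i(1)]] by blast
    then have "m + Poly_Mapping.single j k \<in> Q i"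
      using upsetD[OF primary_onD(1)[OF prim[OF i(1)]]] by (metis add.commute)
    \<comment> \<open>The two monomials differ at most at \<open>j\<close>, so they can disagree on
      \<open>Y\<close> only if \<open>j\<close> is in \<open>Y\<close>.\<close>
    then have "\<not> agree Y m (m + Poly_Mapping.single j k)" by (rule i(2))
    then show "j \<in> Y" by (auto simp: agree_def lookup_add lookup_single when_def split: if_splits)
  qed
  then show "Y \<in> F ` T" using i(1) by blast
qed

section \<open>Effect of a deformation on the associated primes\<close>

lemma agree_upset_of_iff:
  "(\<exists>m'\<in>upset_of G. agree F m m') \<longleftrightarrow> (\<exists>g\<in>G. \<forall>j\<in>F. expo g j \<le> expo (m :: 'n::finite \<Rightarrow>\<^sub>0 nat) j)"
proof
  assume "\<exists>g\<in>G. \<forall>j\<in>F. expo g j \<le> expo m j"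
  then obtain g where g: "g \<in> G" "\<And>j. j \<in> F \<Longrightarrow> expo g j \<le> expo m j" by blast
  \<comment> \<open>The lcm raises \<open>m\<close> only outside \<open>F\<close>, where exponents
    are free.\<close>
  have "mlcm g m \<in> upset_of G" using g(1) unfolding upset_of_def mem_Collect_eq expo_mlcm by (intro bexI[of _ g]) auto
  moreover have "agree F m (mlcm g m)" using g(2) by (simp add: agree_def expo_mlcm max_def)
  ultimately show "\<exists>m'\<in>upset_of G. agree F m m'" by blast
next
  assume "\<exists>m'\<in>upset_of G. agree F m m'"
  then obtain m' g where "agree F m m'" and g: "g \<in> G" "\<And>j. expo g j \<le> expo m' j"
    unfolding upset_of_def by blast
  then have "\<forall>j\<in>F. expo g j \<le> expo m j" by (simp add: agree_def)
  with g(1) show "\<exists>g\<in>G. \<forall>j\<in>F. expo g j \<le> expo m j" by (rule bexI[rotated])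
qed

lemma assoc_supports_upset_of:
  "(F :: 'n::finite set) \<in> assoc_supports (upset_of G) \<longleftrightarrow>
    (\<exists>m. \<not> (\<exists>g\<in>G. \<forall>j\<in>F. expo g j \<le> expo m j) \<and>
      (\<forall>j\<in>F. \<exists>g\<in>G. \<forall>i\<in>F. expo g i \<le> expo (m + Poly_Mapping.single j 1) i))"
  unfolding assoc_supports_def mem_Collect_eq agree_upset_of_iff[symmetric] by blast

text \<open>In each variable a deformation keeps the generators with exponent at most
  \<open>m j\<close> strictly below those above \<open>m j\<close>. The thresholds
  \<open>top\<close> therefore avoid the localised deformed ideal, and multiplying by variables in
  \<open>F\<close> as far as possible gives the witness.\<close>

lemma assoc_supports_deformation:
  fixes G :: "('n::finite \<Rightarrow>\<^sub>0 nat) set"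
  assumes G: "finite G" and def: "deformation G \<epsilon>"
  shows "assoc_supports (upset_of G) \<subseteq> assoc_supports (upset_of ((\<lambda>a. a + \<epsilon> a) ` G))"
proof
  fix F assume "F \<in> assoc_supports (upset_of G)"
  then obtain m where no: "\<not> (\<exists>g\<in>G. \<forall>j\<in>F. expo g j \<le> expo m j)"
    and "\<forall>j\<in>F. \<exists>g\<in>G. \<forall>i\<in>F. expo g i \<le> expo (m + Poly_Mapping.single j 1) i"
    unfolding assoc_supports_upset_of by (elim exE conjE)
  then obtain h where h: "\<And>j. j \<in> F \<Longrightarrow> h j \<in> G"
    "\<And>i j. j \<in> F \<Longrightarrow> i \<in> F \<Longrightarrow> expo (h j) i \<le> expo (m + Poly_Mapping.single j 1) i"
    by (metis (full_types))
  \<comment> \<open>The largest deformed exponent at \<open>j\<close> among the generators with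
    exponent at most \<open>m j\<close>; the inserted 0 covers the case that there are none.\<close>
  define top where "top j = Max (insert 0 ((\<lambda>g. expo (g + \<epsilon> g) j) ` {g\<in>G. expo g j \<le> expo m j}))" for j
  have top_le: "expo (g + \<epsilon> g) j \<le> top j" if "g \<in> G" "expo g j \<le> expo m j" for g j
    unfolding top_def using that G by (intro Max_ge) auto
  have top_less: "top j < expo (g + \<epsilon> g) j" if "g \<in> G" "expo m j < expo g j" for g j
  proof -
    have "expo (g' + \<epsilon> g') j < expo (g + \<epsilon> g) j" if "g' \<in> G" "expo g' j \<le> expo m j" for g'
      using def \<open>g \<in> G\<close> \<open>expo m j < expo g j\<close> that unfolding deformation_def lookup_add
      by (meson le_less_trans)
    then show ?thesis
      unfolding top_def using G that by (subst Max_less_iff) (auto simp: lookup_add)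
  qed
  define P where "P m' \<longleftrightarrow> (\<forall>j\<in>F. top j \<le> expo m' j) \<and>
    \<not> (\<exists>g\<in>G. \<forall>j\<in>F. expo (g + \<epsilon> g) j \<le> expo m' j)" for m'
  have P0: "P (Abs_poly_mapping top)"
    unfolding P_def using no top_less by (fastforce simp: not_le)
  \<comment> \<open>The generator \<open>h j\<close> exceeds \<open>m\<close> on \<open>F\<close> at
    most at \<open>j\<close>, so its deformation stays below \<open>top\<close> elsewhere on
    \<open>F\<close>. An exponent of \<open>m'\<close> at \<open>j\<close> beyond that of the
    deformed \<open>h j\<close> would make the latter divide \<open>m'\<close> on
    \<open>F\<close>.\<close>
  have bound: "degree_on F m' \<le> (\<Sum>j\<in>F. expo (h j + \<epsilon> (h j)) j)" if P: "P m'" for m'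
    unfolding degree_on_def
  proof (rule sum_mono, rule ccontr)
    fix j assume j: "j \<in> F" and less: "\<not> expo m' j \<le> expo (h j + \<epsilon> (h j)) j"
    have "expo (h j + \<epsilon> (h j)) i \<le> expo m' i" if i: "i \<in> F" for i
    proof (cases "i = j")
      case False
      then have "expo (h j) i \<le> expo m i"
        using h(2)[OF j i] by (simp add: lookup_add lookup_single)
      then have "expo (h j + \<epsilon> (h j)) i \<le> top i" using h(1)[OF j] by (rule top_le[rotated])
      also have "top i \<le> expo m' i" using P i by (simp add: P_def)
      finally show ?thesis .
    qed (use less in simp)
    then show False using P h(1)[OF j] by (auto simp: P_def)
  qed
  have "\<exists>m'. P m' \<and> (\<forall>m''. P m'' \<longrightarrow> degree_on F m'' \<le> degree_on F m')"
    by (rule ex_has_greatest_nat[where P = P and b = "Suc (\<Sum>j\<in>F. expo (h j + \<epsilon> (h j)) j)", OF P0])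
      (simp add: bound less_Suc_eq_le)
  then obtain m' where m': "P m'" and max: "\<And>m''. P m'' \<Longrightarrow> degree_on F m'' \<le> degree_on F m'"
    by blast
  \<comment> \<open>By maximality the multiple by the variable \<open>j\<close> violates
    \<open>P\<close>. It stays above \<open>top\<close>, so a deformed generator must divide it on
    \<open>F\<close>.\<close>
  have "\<exists>g\<in>G. \<forall>i\<in>F. expo (g + \<epsilon> g) i \<le> expo (m' + Poly_Mapping.single j 1) i" if j: "j \<in> F" for j
  proof -
    have "1 \<le> degree_on F (Poly_Mapping.single j 1)"
      using j by (intro degree_on_pos_if_meets) simp
    then have "\<not> P (m' + Poly_Mapping.single j 1)"
      using max[of "m' + Poly_Mapping.single j 1"] by (auto simp: degree_on_add)
    moreover have "\<forall>j'\<in>F. top j' \<le> expo (m' + Poly_Mapping.single j 1) j'"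
      using m' by (auto simp: P_def lookup_add intro: trans_le_add1)
    ultimately show ?thesis by (simp add: P_def)
  qed
  then show "F \<in> assoc_supports (upset_of ((\<lambda>a. a + \<epsilon> a) ` G))"
    unfolding assoc_supports_upset_of using m' by (intro exI[of _ m']) (simp add: P_def)
qed

section \<open>Irredundant primary decompositions\<close>

text \<open>Choosing for each generator one variable that divides it gives an irreducible component.\<close>

definition component :: "('n \<Rightarrow>\<^sub>0 nat) set \<Rightarrow> (('n \<Rightarrow>\<^sub>0 nat) \<Rightarrow> 'n) \<Rightarrow> ('n \<Rightarrow>\<^sub>0 nat) set" where
  "component G \<phi> = {m. \<exists>g\<in>G. expo g (\<phi> g) \<le> expo m (\<phi> g)}"

text \<open>The component is generated by powers of the variables \<open>\<phi> g\<close> with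
  exponents taken from \<open>g\<close>; positivity of these exponents keeps 1 out of it.\<close>

lemma primary_on_component:
  assumes "\<And>g. g \<in> G \<Longrightarrow> 0 < expo g (\<phi> g)"
  shows "primary_on (\<phi> ` G) (component G \<phi>)"
  unfolding primary_on_def
proof (intro conjI ballI allI impI)
  fix j assume "j \<in> \<phi> ` G"
  then obtain g where "g \<in> G" "j = \<phi> g" by blast
  then have "Poly_Mapping.single j (expo g j) \<in> component G \<phi>"
    unfolding component_def by (auto intro!: bexI[of _ g])
  then show "\<exists>k. Poly_Mapping.single j k \<in> component G \<phi>" by (rule exI)
next
  show "upset (component G \<phi>)"
    by (auto simp: upset_def component_def lookup_add intro: trans_le_add1)
qed (use assms in \<open>auto simp: component_def agree_def\<close>)

text \<open>A monomial divisible by no generator is smaller than each generator in some variable.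
  Choosing such variables names a component that omits it.\<close>

lemma upset_of_eq_INT_component:
  "upset_of G = (\<Inter>\<phi>\<in>PiE G Poly_Mapping.keys. component G \<phi>)"
proof (intro equalityI subsetI)
  fix m assume m: "m \<in> (\<Inter>\<phi>\<in>PiE G Poly_Mapping.keys. component G \<phi>)"
  show "m \<in> upset_of G"
  proof (rule ccontr)
    assume "m \<notin> upset_of G"
    then obtain \<phi> where \<phi>: "\<And>g. g \<in> G \<Longrightarrow> expo m (\<phi> g) < expo g (\<phi> g)"
      unfolding upset_of_def mem_Collect_eq by (metis not_le)
    have "restrict \<phi> G \<in> PiE G Poly_Mapping.keys"
      using \<phi> by (fastforce simp: in_keys_iff)
    then have "m \<in> component G (restrict \<phi> G)" using m by blast
    then show False using \<phi> by (auto simp: component_def not_le[symmetric])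
  qed
qed (auto simp: upset_of_def component_def)

text \<open>A subfamily of least cardinality with the same intersection can spare no member.\<close>

lemma finite_irredundant_subfamily:
  assumes "finite \<A>"
  obtains \<B> where "\<B> \<subseteq> \<A>" "\<Inter>\<B> = \<Inter>\<A>" "\<And>B. B \<in> \<B> \<Longrightarrow> \<Inter>(\<B> - {B}) \<noteq> \<Inter>\<A>"
proof -
  have "\<exists>\<B>. (\<B> \<subseteq> \<A> \<and> \<Inter>\<B> = \<Inter>\<A>) \<and> (\<forall>\<C>. \<C> \<subseteq> \<A> \<and> \<Inter>\<C> = \<Inter>\<A> \<longrightarrow> card \<B> \<le> card \<C>)"
    by (rule ex_has_least_nat[where P = "\<lambda>\<B>. \<B> \<subseteq> \<A> \<and> \<Inter>\<B> = \<Inter>\<A>" and k = \<A>]) simp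
  then obtain \<B> where \<B>: "\<B> \<subseteq> \<A>" "\<Inter>\<B> = \<Inter>\<A>"
    and min: "\<And>\<C>. \<C> \<subseteq> \<A> \<Longrightarrow> \<Inter>\<C> = \<Inter>\<A> \<Longrightarrow> card \<B> \<le> card \<C>" by metis
  have "\<Inter>(\<B> - {B}) \<noteq> \<Inter>\<A>" if "B \<in> \<B>" for B
  proof
    assume "\<Inter>(\<B> - {B}) = \<Inter>\<A>"
    then have "card \<B> \<le> card (\<B> - {B})" using \<B>(1) by (intro min) auto
    moreover have "card (\<B> - {B}) < card \<B>"
      using finite_subset[OF \<B>(1) assms] that by (rule card_Diff1_less)
    ultimately show False by simp
  qed
  from that[OF \<B> this] show thesis .
qed

lemma ex_irredundant_decomposition:
  fixes G :: "('n::finite \<Rightarrow>\<^sub>0 nat) set"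
  assumes "finite G" "0 \<notin> G"
  shows "\<exists>s U. irredundant_monomial_primary_decomposition s U
    (monomial_span (upset_of G) :: ('n, 'k::idom) mpoly set)"
proof -
  \<comment> \<open>Extensional choice functions keep the family finite, and taking the image merges
    coinciding components.\<close>
  define \<A> where "\<A> = component G ` PiE G Poly_Mapping.keys"
  have "finite \<A>" unfolding \<A>_def using assms(1) by (intro finite_imageI finite_PiE) auto
  then obtain \<B> where \<B>: "\<B> \<subseteq> \<A>" "\<Inter>\<B> = \<Inter>\<A>"
    and irred: "\<And>B. B \<in> \<B> \<Longrightarrow> \<Inter>(\<B> - {B}) \<noteq> \<Inter>\<A>"
    by (rule finite_irredundant_subfamily) blast
  have M: "upset_of G = \<Inter>\<A>" unfolding \<A>_def by (rule upset_of_eq_INT_component)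
  have "finite \<B>" using \<B>(1) \<open>finite \<A>\<close> by (rule finite_subset)
  \<comment> \<open>The enumeration is bijective, so that omitting an index omits exactly one
    component.\<close>
  then obtain h where h: "bij_betw h {1..card \<B>} \<B>" using ex_bij_betw_nat_finite_1 by blast
  have prim: "\<exists>F. primary_on F B" if B: "B \<in> \<B>" for B
  proof -
    obtain \<phi> where "\<phi> \<in> PiE G Poly_Mapping.keys" "B = component G \<phi>"
      using subsetD[OF \<B>(1) B] unfolding \<A>_def by blast
    moreover from this have "0 < expo g (\<phi> g)" if "g \<in> G" for g
      using that by (auto simp: in_keys_iff dest: PiE_mem)
    ultimately show ?thesis using primary_on_component by blast
  qed
  have image: "h ` {1..card \<B>} = \<B>" using h by (rule bij_betw_imp_surj_on)
  have image': "h ` ({1..card \<B>} - {i}) = \<B> - {h i}" if "i \<in> {1..card \<B>}" for i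
    using inj_on_image_set_diff[OF bij_betw_imp_inj_on[OF h], of "{1..card \<B>}" "{i}"] that image
    by simp
  have "irredundant_monomial_primary_decomposition (card \<B>) (\<lambda>i. monomial_span (h i))
    (monomial_span (upset_of G) :: ('n, 'k) mpoly set)"
    unfolding irredundant_monomial_primary_decomposition_def monomial_span_INT[symmetric]
      monomial_span_eq_iff
  proof (intro conjI ballI)
    fix i assume i: "i \<in> {1..card \<B>}"
    then have hi: "h i \<in> \<B>" using image by blast
    with prim obtain F where F: "primary_on F (h i)" by blast
    show "monomial_ideal (monomial_span (h i) :: ('n, 'k) mpoly set)"
      unfolding monomial_ideal_iff using primary_onD(1)[OF F] by (intro exI[of _ "h i"]) simp
    show "primary_ideal mpoly_ring (monomial_span (h i) :: ('n, 'k) mpoly set)"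
      using F by (rule primary_ideal_monomial_span)
    show "(\<Inter>j\<in>{1..card \<B>} - {i}. h j) \<noteq> upset_of G"
      using irred[OF hi] M image'[OF i] by simp
  qed (simp only: image M \<B>(2))
  then show ?thesis by (intro exI)
qed

text \<open>Whatever the decomposition, the radicals of its components are those read off from
  \<open>M\<close>. Distinct indices may share a support, so \<open>F\<close> need not be
  injective.\<close>

lemma decomposition_assoc_supports:
  fixes M :: "('n::finite \<Rightarrow>\<^sub>0 nat) set"
  assumes "irredundant_monomial_primary_decomposition s U (monomial_span M :: ('n, 'k::idom) mpoly set)"
  obtains F N where "\<And>i. i \<in> {1..s} \<Longrightarrow> U i = monomial_span (N i)"
    "\<And>i. i \<in> {1..s} \<Longrightarrow> primary_on (F i) (N i)"
    "F ` {1..s} = assoc_supports M"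
proof -
  have "\<forall>i\<in>{1..s}. \<exists>N. upset N \<and> U i = monomial_span N"
    using assms unfolding irredundant_monomial_primary_decomposition_def monomial_ideal_iff by simp
  then obtain N where N: "\<And>i. i \<in> {1..s} \<Longrightarrow> upset (N i)"
    "\<And>i. i \<in> {1..s} \<Longrightarrow> U i = monomial_span (N i)" by metis
  define F where "F i = {j. \<exists>k. Poly_Mapping.single j k \<in> N i}" for i
  have prim: "primary_on (F i) (N i)" if i: "i \<in> {1..s}" for i
    unfolding F_def
  proof (rule primary_on_if_primary_ideal[OF N(1)[OF i]])
    show "primary_ideal mpoly_ring (monomial_span (N i) :: ('n, 'k) mpoly set)"
      using assms i unfolding irredundant_monomial_primary_decomposition_def N(2)[OF i, symmetric] by blast
  qed
  have inter: "(\<Inter>i\<in>T. U i) = monomial_span (\<Inter>i\<in>T. N i)" if "T \<subseteq> {1..s}" for T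
    unfolding monomial_span_INT using N(2) that by (intro INF_cong) auto
  have "monomial_span M = (\<Inter>i\<in>{1..s}. U i)"
    using assms unfolding irredundant_monomial_primary_decomposition_def by blast
  then have M: "M = (\<Inter>i\<in>{1..s}. N i)" by (simp add: inter)
  have "(\<Inter>j\<in>{1..s} - {i}. N j) \<noteq> (\<Inter>j\<in>{1..s}. N j)" if i: "i \<in> {1..s}" for i
  proof -
    have "(\<Inter>j\<in>{1..s} - {i}. U j) \<noteq> monomial_span M"
      using assms i unfolding irredundant_monomial_primary_decomposition_def by blast
    then show ?thesis by (simp add: inter M)
  qed
  then have "assoc_supports M = F ` {1..s}"
    unfolding M using prim by (intro assoc_supports_INT_primary) auto
  with that N(2) prim show thesis by metis
qed

section \<open>Heights\<close>

text \<open>Appending \<open>Q\<close> to a chain of primes ending in \<open>P\<close> lengthens it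
  by one.\<close>

lemma prime_height_strict:
  assumes P: "primeideal P R" and Q: "primeideal Q R" and less: "P \<subset> Q"
  shows "eSuc (prime_height R P) \<le> prime_height R Q"
proof -
  define H where "H Y = {enat k | k. \<exists>C :: nat \<Rightarrow> 'a set.
    (\<forall>i\<le>k. primeideal (C i) R) \<and> (\<forall>i<k. C i \<subset> C (Suc i)) \<and> C k = Y}" for Y
  have eq: "prime_height R Y = Sup (H Y)" for Y by (simp add: prime_height_def H_def)
  \<comment> \<open>The chain of length 0 makes the set nonempty, as required for
    \<open>eSuc\<close> to commute with \<open>Sup\<close>.\<close>
  have "enat 0 \<in> H P" unfolding H_def using P by (auto intro!: exI[of _ "\<lambda>_. P"])
  then have "eSuc (Sup (H P)) = Sup (eSuc ` H P)" by (intro eSuc_Sup) blast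
  also have "\<dots> \<le> Sup (H Q)"
  proof (rule Sup_subset_mono, rule image_subsetI)
    fix x assume "x \<in> H P"
    then obtain k C where x: "x = enat k" and C: "\<And>i. i \<le> k \<Longrightarrow> primeideal (C i) R"
      "\<And>i. i < k \<Longrightarrow> C i \<subset> C (Suc i)" "C k = P" unfolding H_def by blast
    have "\<forall>i\<le>Suc k. primeideal ((C(Suc k := Q)) i) R"
      using C(1) Q by (simp add: le_Suc_eq)
    moreover have "\<forall>i<Suc k. (C(Suc k := Q)) i \<subset> (C(Suc k := Q)) (Suc i)"
      using C(2,3) less by (auto simp: less_Suc_eq)
    ultimately show "eSuc x \<in> H Q"
      unfolding H_def x eSuc_enat mem_Collect_eq
      by (intro exI[of _ "Suc k"] conjI exI[of _ "C(Suc k := Q)"]) auto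
  qed
  finally show ?thesis by (simp add: eq)
qed

lemma prime_height_mono:
  assumes "primeideal P R" "primeideal Q R" "P \<subseteq> Q"
  shows "prime_height R P \<le> prime_height R Q"
proof (cases "P = Q")
  case False
  then have "eSuc (prime_height R P) \<le> prime_height R Q"
    using assms by (intro prime_height_strict) auto
  then show ?thesis using ile_eSuc order_trans by blast
qed simp

lemma height_eq_prime_height:
  assumes "primeideal P R" "J \<subseteq> P" "\<And>Q. primeideal Q R \<Longrightarrow> J \<subseteq> Q \<Longrightarrow> P \<subseteq> Q"
  shows "height R J = prime_height R P"
  unfolding height_def
proof (rule antisym)
  show "Inf {prime_height R P | P. primeideal P R \<and> J \<subseteq> P} \<le> prime_height R P"
    using assms(1,2) by (intro Inf_lower) blast
  show "prime_height R P \<le> Inf {prime_height R P | P. primeideal P R \<and> J \<subseteq> P}"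
    using assms(1,3) by (intro Inf_greatest) (auto intro: prime_height_mono)
qed

text \<open>Each additional variable gives a strictly larger prime, so the height rises by at least
  one per variable.\<close>

lemma prime_height_span_meets_Un:
  fixes V D :: "'n::finite set"
  assumes "V \<inter> D = {}"
  shows "prime_height mpoly_ring (monomial_span (meets V) :: ('n, 'k::idom) mpoly set) + enat (card D)
    \<le> prime_height mpoly_ring (monomial_span (meets (V \<union> D)) :: ('n, 'k) mpoly set)"
proof -
  have "finite D" by simp
  then show ?thesis using assms
  proof (induction D)
    case empty
    then show ?case by (simp flip: zero_enat_def)
  next
    case (insert j D)
    let ?P = "\<lambda>F. monomial_span (meets F) :: ('n, 'k) mpoly set"
    have "\<not> V \<union> insert j D \<subseteq> V \<union> D" using insert.hyps(2) insert.prems by blast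
    then have "\<not> ?P (V \<union> insert j D) \<subseteq> ?P (V \<union> D)"
      unfolding monomial_span_subset_iff meets_subset_iff .
    moreover have "?P (V \<union> D) \<subseteq> ?P (V \<union> insert j D)"
      unfolding monomial_span_subset_iff meets_subset_iff by blast
    ultimately have "?P (V \<union> D) \<subset> ?P (V \<union> insert j D)" unfolding less_le_not_le by (rule conjI[rotated])
    then have step: "eSuc (prime_height mpoly_ring (?P (V \<union> D)))
        \<le> prime_height mpoly_ring (?P (V \<union> insert j D))"
      by (intro prime_height_strict primeideal_span_meets)
    have "prime_height mpoly_ring (?P V) + enat (card (insert j D))
        = eSuc (prime_height mpoly_ring (?P V) + enat (card D))"
      using insert.hyps by (simp add: iadd_Suc_right flip: eSuc_enat)
    also have "\<dots> \<le> eSuc (prime_height mpoly_ring (?P (V \<union> D)))"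
      using insert.IH insert.prems by simp
    also note step
    finally show ?case .
  qed
qed

text \<open>A prime containing a power of a variable contains the variable, so the prime generated
  by \<open>F\<close> is the least prime over the ideal, and the infimum defining the height is
  attained there.\<close>

lemma height_monomial_span:
  fixes M :: "('n::finite \<Rightarrow>\<^sub>0 nat) set"
  assumes "M \<subseteq> meets F" "\<And>j. j \<in> F \<Longrightarrow> \<exists>k. Poly_Mapping.single j k \<in> M"
  shows "height mpoly_ring (monomial_span M :: ('n, 'k::idom) mpoly set)
    = prime_height mpoly_ring (monomial_span (meets F) :: ('n, 'k) mpoly set)"
proof (rule height_eq_prime_height[OF primeideal_span_meets])
  show "(monomial_span M :: ('n, 'k) mpoly set) \<subseteq> monomial_span (meets F)"
    using assms(1) by simp
next
  fix Q :: "('n, 'k) mpoly set"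
  assume Q: "primeideal Q mpoly_ring" and sub: "monomial_span M \<subseteq> Q"
  interpret primeideal Q mpoly_ring by (rule Q)
  have one: "1 \<notin> Q" using one_imp_carrier I_notcarr by auto
  have var: "xpow (Poly_Mapping.single j 1) \<in> Q" if j: "j \<in> F" for j
  proof -
    obtain k where "Poly_Mapping.single j k \<in> M" using assms(2)[OF j] by blast
    then have "(xpow (Poly_Mapping.single j k) :: ('n, 'k) mpoly) \<in> Q"
      by (intro subsetD[OF sub]) simp
    then show ?thesis
    proof (induction k)
      case 0
      then show ?case using one by (simp add: xpow_def)
    next
      case (Suc k)
      have "xpow (Poly_Mapping.single j 1) * xpow (Poly_Mapping.single j k) \<in> Q"
        using Suc.prems by (simp flip: xpow_add single_add)
      then show ?case
        using I_prime[of "xpow (Poly_Mapping.single j 1)" "xpow (Poly_Mapping.single j k)"] Suc.IH by auto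
    qed
  qed
  have "xpow m \<in> Q" if "m \<in> meets F" for m
  proof -
    obtain j where j: "j \<in> F" "0 < expo m j" using \<open>m \<in> meets F\<close> by (auto simp: meets_def)
    show ?thesis
      by (rule ideal_xpow_mono[OF ideal_axioms var[OF j(1)]])
        (use j(2) in \<open>auto simp: lookup_single when_def\<close>)
  qed
  then show "monomial_span (meets F) \<subseteq> Q"
    unfolding monomial_span_def by (intro subsetI) (auto intro: in_ideal_if_monomials[OF ideal_axioms])
qed

section \<open>Size\<close>

text \<open>Requiring a nonempty subfamily mirrors \<open>decomposition_v\<close>: for a nonempty
  family with empty union the number is 1.\<close>

definition cover_number :: "'a set set \<Rightarrow> nat" where
  "cover_number \<A> = (LEAST t. \<exists>\<F>\<subseteq>\<A>. \<F> \<noteq> {} \<and> card \<F> = t \<and> \<Union>\<F> = \<Union>\<A>)"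

lemma cover_number_le: "\<F> \<subseteq> \<A> \<Longrightarrow> \<F> \<noteq> {} \<Longrightarrow> \<Union>\<F> = \<Union>\<A> \<Longrightarrow> cover_number \<A> \<le> card \<F>"
  unfolding cover_number_def by (rule Least_le) blast

lemma ex_minimal_cover:
  assumes "\<A> \<noteq> {}"
  obtains \<F> where "\<F> \<subseteq> \<A>" "\<F> \<noteq> {}" "card \<F> = cover_number \<A>" "\<Union>\<F> = \<Union>\<A>"
proof -
  have "\<exists>t. \<exists>\<F>\<subseteq>\<A>. \<F> \<noteq> {} \<and> card \<F> = t \<and> \<Union>\<F> = \<Union>\<A>" using assms by blast
  from LeastI_ex[OF this] show thesis using that unfolding cover_number_def by blast
qed

text \<open>To an optimal cover from \<open>\<A>\<close> one adds, for each point not yet covered,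
  one member of \<open>\<B>\<close> containing it.\<close>

lemma cover_number_superset:
  assumes sub: "\<A> \<subseteq> \<B>" and ne: "\<A> \<noteq> {}" and fin: "finite (\<Union>\<B>)"
  shows "cover_number \<B> \<le> cover_number \<A> + card (\<Union>\<B> - \<Union>\<A>)"
proof -
  obtain \<F> where \<F>: "\<F> \<subseteq> \<A>" "\<F> \<noteq> {}" "card \<F> = cover_number \<A>" "\<Union>\<F> = \<Union>\<A>"
    using ne by (rule ex_minimal_cover)
  define D where "D = \<Union>\<B> - \<Union>\<A>"
  have "\<forall>x\<in>D. \<exists>B\<in>\<B>. x \<in> B" unfolding D_def by blast
  then obtain f where f: "\<And>x. x \<in> D \<Longrightarrow> f x \<in> \<B>" "\<And>x. x \<in> D \<Longrightarrow> x \<in> f x" by metis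
  have "\<Union>(\<F> \<union> f ` D) = \<Union>\<B>"
  proof (intro equalityI subsetI)
    fix x assume x: "x \<in> \<Union>\<B>"
    show "x \<in> \<Union>(\<F> \<union> f ` D)"
    proof (cases "x \<in> D")
      case True
      then show ?thesis using f(2) by blast
    next
      case False
      then have "x \<in> \<Union>\<F>" using x unfolding D_def \<F>(4) by blast
      then show ?thesis by blast
    qed
  next
    fix x assume "x \<in> \<Union>(\<F> \<union> f ` D)"
    then show "x \<in> \<Union>\<B>" using \<F>(1) sub f(1) by blast
  qed
  then have "cover_number \<B> \<le> card (\<F> \<union> f ` D)"
    using \<F>(1,2) sub f(1) by (intro cover_number_le) auto
  also have "\<dots> \<le> card \<F> + card (f ` D)" by (rule card_Un_le)
  also have "card (f ` D) \<le> card D" using fin by (intro card_image_le) (simp add: D_def)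
  finally show ?thesis by (simp add: \<F>(3) D_def)
qed

text \<open>Selections of indices and families of supports have the same minimal size: the image of
  an index set is no larger, and a family lifts to an index set on which \<open>F\<close> is
  injective.\<close>

lemma decomposition_v_eq:
  assumes iff: "\<And>T. T \<subseteq> {1..s} \<Longrightarrow>
      radical mpoly_ring (ideal_sum mpoly_ring T U) = radical mpoly_ring (ideal_sum mpoly_ring {1..s} U)
      \<longleftrightarrow> \<Union>(F ` T) = \<Union>(F ` {1..s})"
    and s: "{1..s} \<noteq> {}"
  shows "decomposition_v s U = cover_number (F ` {1..s})"
proof -
  define P where "P t \<longleftrightarrow> (\<exists>T. T \<subseteq> {1..s} \<and> T \<noteq> {} \<and> card T = t \<and> \<Union>(F ` T) = \<Union>(F ` {1..s}))" for t
  have "(\<exists>T. T \<subseteq> {1..s} \<and> T \<noteq> {} \<and> card T = t \<and>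
      radical mpoly_ring (ideal_sum mpoly_ring T U) = radical mpoly_ring (ideal_sum mpoly_ring {1..s} U))
      \<longleftrightarrow> P t" for t
    unfolding P_def by (intro ex_cong1 conj_cong refl iff)
  then have v: "decomposition_v s U = (LEAST t. P t)"
    unfolding decomposition_v_def by (simp only:)
  have "P (card {1..s})" unfolding P_def using s by blast
  then have "P (LEAST t. P t)" by (rule LeastI)
  then obtain T where T: "T \<subseteq> {1..s}" "T \<noteq> {}" "card T = (LEAST t. P t)" "\<Union>(F ` T) = \<Union>(F ` {1..s})"
    unfolding P_def by blast
  have "cover_number (F ` {1..s}) \<le> card (F ` T)"
    using T by (intro cover_number_le) auto
  also have "\<dots> \<le> (LEAST t. P t)"
    unfolding T(3)[symmetric] using finite_subset[OF T(1)] by (intro card_image_le) simp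
  finally have "cover_number (F ` {1..s}) \<le> (LEAST t. P t)" .
  moreover have "F ` {1..s} \<noteq> {}" using s by blast
  then obtain \<F> where \<F>: "\<F> \<subseteq> F ` {1..s}" "\<F> \<noteq> {}" "card \<F> = cover_number (F ` {1..s})"
    "\<Union>\<F> = \<Union>(F ` {1..s})" by (rule ex_minimal_cover)
  from \<F>(1) obtain T' where T': "T' \<subseteq> {1..s}" "inj_on F T'" "\<F> = F ` T'"
    unfolding subset_image_inj by blast
  have "P (cover_number (F ` {1..s}))"
    unfolding P_def
  proof (intro exI conjI)
    show "T' \<noteq> {}" using \<F>(2) T'(3) by blast
    show "card T' = cover_number (F ` {1..s})" using \<F>(3) T'(2,3) by (simp add: card_image)
    show "\<Union>(F ` T') = \<Union>(F ` {1..s})" using \<F>(4) T'(3) by simp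
  qed (rule T'(1))
  then have "(LEAST t. P t) \<le> cover_number (F ` {1..s})" by (rule Least_le)
  ultimately show ?thesis using v by simp
qed

text \<open>The radical of a sum of components is generated by the union of their supports, so
  comparing radicals means comparing unions, and the height is that of a prime generated by
  variables. The right-hand side no longer mentions the decomposition.\<close>

lemma decomposition_size_eq:
  fixes M :: "('n::finite \<Rightarrow>\<^sub>0 nat) set" and U :: "nat \<Rightarrow> ('n, 'k::idom) mpoly set"
  assumes dec: "irredundant_monomial_primary_decomposition s U (monomial_span M)" and M: "0 \<notin> M"
  shows "assoc_supports M \<noteq> {}"
    and "decomposition_size s U = ereal (real (cover_number (assoc_supports M))) +
      (ereal (real (card (UNIV :: 'n set))) - ereal_of_enat (prime_height mpoly_ring
        (monomial_span (meets (\<Union>(assoc_supports M))) :: ('n, 'k) mpoly set))) - 1"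
proof -
  obtain N F where U: "\<And>i. i \<in> {1..s} \<Longrightarrow> U i = monomial_span (N i)"
    and prim: "\<And>i. i \<in> {1..s} \<Longrightarrow> primary_on (F i) (N i)"
    and F: "F ` {1..s} = assoc_supports M"
    by (rule decomposition_assoc_supports[OF dec]) (rule that)
  have "(monomial_span M :: ('n, 'k) mpoly set) \<noteq> UNIV" using M by (rule monomial_span_neq_UNIV)
  moreover have "monomial_span M = (\<Inter>i\<in>{1..s}. U i)"
    using dec unfolding irredundant_monomial_primary_decomposition_def by blast
  \<comment> \<open>With no components the intersection would be the whole ring.\<close>
  ultimately have s: "{1..s} \<noteq> {}" by auto
  then show "assoc_supports M \<noteq> {}" unfolding F[symmetric] by blast
  have sum: "ideal_sum mpoly_ring T U = monomial_span (\<Union>i\<in>T. N i)" if "T \<subseteq> {1..s}" for T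
  proof -
    have "ideal_sum mpoly_ring T U = ideal_sum mpoly_ring T (\<lambda>i. monomial_span (N i))"
      unfolding ideal_sum_def using U that by (intro arg_cong[where f = "genideal mpoly_ring"] SUP_cong) auto
    also have "\<dots> = monomial_span (\<Union>i\<in>T. N i)"
      using primary_onD(1)[OF prim] that by (intro ideal_sum_monomial_span) blast
    finally show ?thesis .
  qed
  have meets: "(\<Union>i\<in>T. N i) \<subseteq> meets (\<Union>(F ` T))" if T: "T \<subseteq> {1..s}" for T
  proof
    fix m assume "m \<in> (\<Union>i\<in>T. N i)"
    then obtain i where "i \<in> T" "m \<in> N i" by blast
    moreover from this have "m \<in> meets (F i)" using primary_on_subset_meets[OF prim] T by blast
    ultimately show "m \<in> meets (\<Union>(F ` T))" by (auto simp: meets_def)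
  qed
  have pow: "\<exists>k. Poly_Mapping.single j k \<in> (\<Union>i\<in>T. N i)" if "T \<subseteq> {1..s}" "j \<in> \<Union>(F ` T)" for T j
    using primary_onD(3)[OF prim] that by blast
  have ups: "upset (\<Union>i\<in>T. N i)" if "T \<subseteq> {1..s}" for T
    using primary_onD(1)[OF prim] that unfolding upset_def by blast
  have rad: "radical mpoly_ring (ideal_sum mpoly_ring T U) = monomial_span (meets (\<Union>(F ` T)))"
    if T: "T \<subseteq> {1..s}" for T
    unfolding sum[OF T] using ups[OF T] meets[OF T] pow[OF T] by (rule radical_monomial_span)
  have "decomposition_v s U = cover_number (F ` {1..s})"
  proof (rule decomposition_v_eq[OF _ s])
    show "radical mpoly_ring (ideal_sum mpoly_ring T U) = radical mpoly_ring (ideal_sum mpoly_ring {1..s} U)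
      \<longleftrightarrow> \<Union>(F ` T) = \<Union>(F ` {1..s})" if T: "T \<subseteq> {1..s}" for T
      unfolding rad[OF T] rad[OF subset_refl] monomial_span_eq_iff meets_eq_iff by (rule refl)
  qed
  moreover have "height mpoly_ring (ideal_sum mpoly_ring {1..s} U) =
      prime_height mpoly_ring (monomial_span (meets (\<Union>(F ` {1..s}))) :: ('n, 'k) mpoly set)"
    unfolding sum[OF subset_refl] using meets[OF subset_refl] pow[OF subset_refl]
    by (rule height_monomial_span)
  ultimately show "decomposition_size s U = ereal (real (cover_number (assoc_supports M))) +
      (ereal (real (card (UNIV :: 'n set))) - ereal_of_enat (prime_height mpoly_ring
        (monomial_span (meets (\<Union>(assoc_supports M))) :: ('n, 'k) mpoly set))) - 1"
    unfolding decomposition_size_def F by simp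
qed

section \<open>Size of an ideal given by generators\<close>

lemma zero_notin_upset_of: "0 \<notin> G \<Longrightarrow> 0 \<notin> upset_of G"
proof
  assume "0 \<notin> G" "0 \<in> upset_of G"
  then obtain g where "g \<in> G" "\<And>j. expo g j = 0" by (auto simp: upset_of_def)
  moreover from this(2) have "g = 0" by (intro poly_mapping_eqI) simp
  ultimately show False using \<open>0 \<notin> G\<close> by simp
qed

text \<open>A decomposition exists and all decompositions give the same value, so the definite
  description in \<open>ideal_size\<close> denotes it.\<close>

lemma ideal_size_eq:
  fixes G :: "('n::finite \<Rightarrow>\<^sub>0 nat) set"
  assumes G: "finite G" "0 \<notin> G"
  shows "assoc_supports (upset_of G) \<noteq> {}"
    and "ideal_size (monomial_span (upset_of G) :: ('n, 'k::idom) mpoly set) =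
      ereal (real (cover_number (assoc_supports (upset_of G)))) +
      (ereal (real (card (UNIV :: 'n set))) - ereal_of_enat (prime_height mpoly_ring
        (monomial_span (meets (\<Union>(assoc_supports (upset_of G)))) :: ('n, 'k) mpoly set))) - 1"
proof -
  note size = decomposition_size_eq[OF _ zero_notin_upset_of[OF G(2)]]
  obtain s and U :: "nat \<Rightarrow> ('n, 'k) mpoly set"
    where dec: "irredundant_monomial_primary_decomposition s U (monomial_span (upset_of G))"
    using ex_irredundant_decomposition[OF G] by blast
  show "assoc_supports (upset_of G) \<noteq> {}" by (rule size(1)[OF dec])
  show "ideal_size (monomial_span (upset_of G) :: ('n, 'k) mpoly set) =
      ereal (real (cover_number (assoc_supports (upset_of G)))) +
      (ereal (real (card (UNIV :: 'n set))) - ereal_of_enat (prime_height mpoly_ring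
        (monomial_span (meets (\<Union>(assoc_supports (upset_of G)))) :: ('n, 'k) mpoly set))) - 1" (is "_ = ?d")
    unfolding ideal_size_def
  proof (rule the_equality)
    show "\<exists>s U. irredundant_monomial_primary_decomposition s U
        (monomial_span (upset_of G) :: ('n, 'k) mpoly set) \<and> ?d = decomposition_size s U"
      using dec size(2)[OF dec, symmetric] by (intro exI conjI)
  next
    fix d assume "\<exists>s U. irredundant_monomial_primary_decomposition s U
        (monomial_span (upset_of G) :: ('n, 'k) mpoly set) \<and> d = decomposition_size s U"
    then show "d = ?d" by (elim exE conjE) (simp only: size(2))
  qed
qed

text \<open>Infinite heights are covered as well: an infinite \<open>h\<close> forces
  \<open>h'\<close> to be infinite, and an infinite \<open>h'\<close> makes the left-hand side minus
  infinity.\<close>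

lemma ereal_size_mono:
  fixes h h' :: enat
  assumes "a' \<le> a + d" "h + enat d \<le> h'"
  shows "ereal (real a') + (ereal (real n) - ereal_of_enat h') - 1
    \<le> ereal (real a) + (ereal (real n) - ereal_of_enat h) - 1"
  using assms by (cases h; cases h') (auto simp: one_ereal_def)

section \<open>Comparison of the two sizes\<close>

theorem proposition4p4:
  fixes I I\<^sub>\<epsilon> :: "('n::finite, 'k::field) mpoly set"
    and G :: "('n \<Rightarrow>\<^sub>0 nat) set"
    and \<epsilon> :: "('n \<Rightarrow>\<^sub>0 nat) \<Rightarrow> ('n \<Rightarrow>\<^sub>0 nat)"
  assumes "monomial_ideal I" and "I \<noteq> UNIV"
    and "finite G" and "I = Idl\<^bsub>mpoly_ring\<^esub> (xpow ` G)"
    and "deformation G \<epsilon>"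
    and "I\<^sub>\<epsilon> = deformed_ideal G \<epsilon>"
    and "generic_ideal I\<^sub>\<epsilon>"
  shows "ideal_size I \<ge> ideal_size I\<^sub>\<epsilon>"
proof -
  define G' where "G' = (\<lambda>a. a + \<epsilon> a) ` G"
  have I: "I = monomial_span (upset_of G)" using assms(4) by (simp add: Idl_xpow)
  have "(\<lambda>a. xpow a * xpow (\<epsilon> a)) ` G = (xpow ` G' :: ('n, 'k) mpoly set)"
    unfolding G'_def image_image xpow_add ..
  then have I\<epsilon>: "I\<^sub>\<epsilon> = monomial_span (upset_of G')"
    using assms(6) by (simp add: deformed_ideal_def Idl_xpow)
  have G0: "0 \<notin> G"
  proof
    assume "0 \<in> G"
    then have "upset_of G = UNIV" by (auto simp: upset_of_def intro!: bexI[of _ 0])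
    then show False using assms(2) I by simp
  qed
  have G'0: "0 \<notin> G'"
  proof
    assume "0 \<in> G'"
    then obtain a where "a \<in> G" and a: "a + \<epsilon> a = 0" by (auto simp: G'_def)
    have "expo a j = 0" for j using arg_cong[OF a, of "\<lambda>b. expo b j"] by (simp add: lookup_add)
    then have "a = 0" by (intro poly_mapping_eqI) simp
    with \<open>a \<in> G\<close> G0 show False by simp
  qed
  have "finite G'" using assms(3) by (simp add: G'_def)
  let ?A = "assoc_supports (upset_of G)" and ?A' = "assoc_supports (upset_of G')"
  have sub: "?A \<subseteq> ?A'" unfolding G'_def using assms(3,5) by (rule assoc_supports_deformation)
  \<comment> \<open>The number of new variables, those in \<open>\<Union>?A' - \<Union>?A\<close>,
    controls both estimates: the cover number grows by at most this number, the height by at least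
    this number.\<close>
  have cover: "cover_number ?A' \<le> cover_number ?A + card (\<Union>?A' - \<Union>?A)"
    using sub ideal_size_eq(1)[OF assms(3) G0] by (rule cover_number_superset) simp
  have "\<Union>?A \<union> (\<Union>?A' - \<Union>?A) = \<Union>?A'" using sub by blast
  then have "prime_height mpoly_ring (monomial_span (meets (\<Union>?A)) :: ('n, 'k) mpoly set)
      + enat (card (\<Union>?A' - \<Union>?A))
    \<le> prime_height mpoly_ring (monomial_span (meets (\<Union>?A')) :: ('n, 'k) mpoly set)"
    using prime_height_span_meets_Un[of "\<Union>?A" "\<Union>?A' - \<Union>?A"] by (metis Diff_disjoint)
  then show ?thesis
    unfolding I I\<epsilon> ideal_size_eq(2)[OF assms(3) G0] ideal_size_eq(2)[OF \<open>finite G'\<close> G'0]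
    by (rule ereal_size_mono[OF cover])
qed

end
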